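(* Let $p\ge 1$ be an integer, let $f\in\mathcal E_p$ with zeros $-\lambda_m$ ($0\le\lambda_1\le\lambda_2\le\cdots$, counted with multiplicity), and let $0\le a_1\le\cdots\le a_n$ and $0\le b_1\le\cdots\le b_n$ be real numbers with $\sum_{k=1}^n a_k=\sum_{k=1}^n b_k$. Let $W_f(z)=\prod_{k=1}^n f(z+a_k)\big/\prod_{k=1}^n f(z+b_k)$, and put $$h(s)=\sum_{m\ge 1} e^{-\lambda_m s},\qquad g(s)=\frac1{s^2}\sum_{k=1}^n\left(e^{-sa_k}-e^{-sb_k}\right)\qquad(s>0),$$ $$\rho(t)=\sum_{k=1}^n (t-a_k)\mathbf 1_{[a_k,\infty)}(t)-\sum_{k=1}^n (t-b_k)\mathbf 1_{[b_k,\infty)}(t),\qquad \phi(t)=\sum_{m\ge 1}\rho(t-\lambda_m).$$ Then for all $z$ with $\Re z>0$, $$(-1)^{p}\partial_z^{p-1}\log W_f(z)=\int_0^\infty e^{-sz}s^{p}h(s)g(s)\,ds=\Gamma(p+1)\int_0^\infty\frac{\phi(t)\,dt}{(z+t)^{p+1}}.$$ Moreover, if $b\prec_w a$, then $(-1)^{p}\partial_z^{p-1}\log W_f(z)$ is a generalised Stieltjes function of order $p+1$.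
   Context: $\mathcal E_p$ denotes the class of entire functions $f$ that are real on the real axis, of genus $p$, have only real and non-positive zeros, and satisfy $f(x)>0$ for $x>0$. The zeros are written $-\lambda_m$, listed with multiplicity, and sums over $m$ run over all zeros. $\log f$ denotes the holomorphic branch on $\mathbb C\setminus(-\infty,0]$ that is real on $(0,\infty)$, and $\log W_f(z)=\sum_{k=1}^n(\log f(z+a_k)-\log f(z+b_k))$. $\partial_z$ is differentiation with respect to $z$ (with $\partial_z^0$ the identity), and $\mathbf 1_S$ is the indicator function of $S$. Weak supermajorisation: $b\prec_w a$ means $\sum_{k=1}^m a_k\le\sum_{k=1}^m b_k$ for all $m\in\{1,\ldots,n\}$ (sequences in non-decreasing order). A function $F$ on $(0,\infty)$ is a generalised Stieltjes function of order $\lambda>0$ if $F(x)=\int_0^\infty \frac{d\mu(t)}{(t+x)^\lambda}+c$ for all $x>0$, for some positive (i.e. non-negative) measure $\mu$ on $[0,\infty)$ making the integral converge and some $c\ge 0$. A function of a complex variable is called generalised Stieltjes if its restriction to $(0,\infty)$ is. *)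

theory Defs
  imports
    "HOL-Complex_Analysis.Complex_Analysis"
    "HOL-Computational_Algebra.Polynomial"
begin

(* Genus p in the sense of the Hadamard factorisation
     f(z) = z^d * exp(q(z)) * (product over i in I of E_r(z / w_i)),
   where the w_i (finitely or infinitely many) are then the nonzero zeros of f with multiplicity,
   r is the least exponent for which the sum of |w_i|^{-(r+1)} converges, and p = max(deg q, r).
   The nonzero constant factor is absorbed into q. The product is indexed by nat with factor 1
   off I; for i in I the elementary factor E_r(z / w_i) is the library's weierstrass_factor. *)
definition has_genus :: "(complex \<Rightarrow> complex) \<Rightarrow> nat \<Rightarrow> bool" where
  "has_genus f p \<longleftrightarrow>
    (\<exists>(d :: nat) (q :: complex poly) (r :: nat) (I :: nat set) (w :: nat \<Rightarrow> complex).
       (\<forall>i\<in>I. w i \<noteq> 0) \<and>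
       (\<lambda>i. 1 / norm (w i) ^ (r + 1)) summable_on I \<and>
       (\<forall>r'<r. \<not> (\<lambda>i. 1 / norm (w i) ^ (r' + 1)) summable_on I) \<and>
       (\<forall>z. f z = z ^ d * exp (poly q z) *
          (\<Prod>i. if i \<in> I then weierstrass_factor r (z / w i) else 1)) \<and>
       p = max (degree q) r)"

definition class_E :: "nat \<Rightarrow> (complex \<Rightarrow> complex) set" where
  "class_E p =
    {f. f holomorphic_on UNIV \<and> has_genus f p \<and>
        (\<forall>x::real. f (of_real x) \<in> \<real>) \<and>
        (\<forall>z. f z = 0 \<longrightarrow> z \<in> \<real>\<^sub>\<le>\<^sub>0) \<and>
        (\<forall>x::real. x > 0 \<longrightarrow> Re (f (of_real x)) > 0)}"

(* The zeros of f are - lam m for m in I, in the order of increasing modulus and with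
   multiplicity. I is an initial segment of the positive integers since f may have finitely many
   zeros, or none. As zorder is positive at a zero, the equation for card forces the set to be
   finite. *)
definition lists_zeros :: "(complex \<Rightarrow> complex) \<Rightarrow> nat set \<Rightarrow> (nat \<Rightarrow> real) \<Rightarrow> bool" where
  "lists_zeros f I lam \<longleftrightarrow>
    (I = {1..} \<or> (\<exists>N. I = {1..N})) \<and>
    mono_on I lam \<and> (\<forall>m\<in>I. 0 \<le> lam m) \<and>
    (\<forall>m\<in>I. f (- of_real (lam m)) = 0) \<and>
    (\<forall>w. f w = 0 \<longrightarrow> int (card {m\<in>I. - of_real (lam m) = w}) = zorder f w)"

(* The holomorphic logarithm on the slit plane that is real on the positive axis: these
   conditions determine it there when f is in class_E p. Its values on the slit are irrelevant. *)
definition log_branch :: "(complex \<Rightarrow> complex) \<Rightarrow> complex \<Rightarrow> complex" where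
  "log_branch f =
    (SOME L. L holomorphic_on (- \<real>\<^sub>\<le>\<^sub>0) \<and> (\<forall>z\<in>- \<real>\<^sub>\<le>\<^sub>0. exp (L z) = f z) \<and>
             (\<forall>x::real. x > 0 \<longrightarrow> L (of_real x) \<in> \<real>))"

definition log_W ::
  "(complex \<Rightarrow> complex) \<Rightarrow> nat \<Rightarrow> (nat \<Rightarrow> real) \<Rightarrow> (nat \<Rightarrow> real) \<Rightarrow> complex \<Rightarrow> complex" where
  "log_W f n a b z =
    (\<Sum>k=1..n. log_branch f (z + of_real (a k)) - log_branch f (z + of_real (b k)))"

definition h_fun :: "nat set \<Rightarrow> (nat \<Rightarrow> real) \<Rightarrow> real \<Rightarrow> real" where
  "h_fun I lam s = (\<Sum>\<^sub>\<infinity>m\<in>I. exp (- lam m * s))"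

definition g_fun :: "nat \<Rightarrow> (nat \<Rightarrow> real) \<Rightarrow> (nat \<Rightarrow> real) \<Rightarrow> real \<Rightarrow> real" where
  "g_fun n a b s = 1 / s\<^sup>2 * (\<Sum>k=1..n. exp (- s * a k) - exp (- s * b k))"

definition rho :: "nat \<Rightarrow> (nat \<Rightarrow> real) \<Rightarrow> (nat \<Rightarrow> real) \<Rightarrow> real \<Rightarrow> real" where
  "rho n a b t =
    (\<Sum>k=1..n. (t - a k) * indicator {a k..} t) - (\<Sum>k=1..n. (t - b k) * indicator {b k..} t)"

definition phi ::
  "nat set \<Rightarrow> (nat \<Rightarrow> real) \<Rightarrow> nat \<Rightarrow> (nat \<Rightarrow> real) \<Rightarrow> (nat \<Rightarrow> real) \<Rightarrow> real \<Rightarrow> real" where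
  "phi I lam n a b t = (\<Sum>\<^sub>\<infinity>m\<in>I. rho n a b (t - lam m))"

(* weak_supermajorised n b a is b \<prec>\<^sub>w a, for sequences in non-decreasing order. *)
definition weak_supermajorised :: "nat \<Rightarrow> (nat \<Rightarrow> real) \<Rightarrow> (nat \<Rightarrow> real) \<Rightarrow> bool" where
  "weak_supermajorised n b a \<longleftrightarrow> (\<forall>m\<in>{1..n}. (\<Sum>k=1..m. a k) \<le> (\<Sum>k=1..m. b k))"

definition generalised_Stieltjes :: "real \<Rightarrow> (real \<Rightarrow> real) \<Rightarrow> bool" where
  "generalised_Stieltjes \<kappa> F \<longleftrightarrow> \<kappa> > 0 \<and>
    (\<exists>(\<mu> :: real measure) (c :: real).
       sets \<mu> = sets (restrict_space borel {0..}) \<and> c \<ge> 0 \<and>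
       (\<forall>x>0. integrable \<mu> (\<lambda>t. 1 / (t + x) powr \<kappa>) \<and>
              F x = (\<integral>t. 1 / (t + x) powr \<kappa> \<partial>\<mu>) + c))"

definition generalised_Stieltjes_complex :: "real \<Rightarrow> (complex \<Rightarrow> complex) \<Rightarrow> bool" where
  "generalised_Stieltjes_complex \<kappa> F \<longleftrightarrow>
    (\<exists>G. generalised_Stieltjes \<kappa> G \<and> (\<forall>x>0. F (of_real x) = of_real (G x)))"

end

theory Submission
  imports Defs
begin

text \<open>
  Put $F = \partial_z^{p-1} \log f$. Two derivatives more remove everything in the Hadamard
  factorisation of $f$ except its zeros: the exponent $q$ has degree at most $p$, and the logarithm of
  an elementary factor $E_r(z/w)$ with $r \le p$ is $\log(1 - z/w)$ plus a polynomial of degree at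
  most $p$. Hence
  \[(-1)^p F''(z) = p! \sum_m (z + \lambda_m)^{-(p+1)}\]
  (\<open>higher_deriv_log_branch\<close>).

  The function $\rho$ is the kernel of the second-order Taylor formula. As
  $F(z+c) = F(z+\tau) - (\tau-c) F'(z+\tau) + \int_c^\tau (u-c) F''(z+u)\,du$, the boundary terms of
  $\sum_k (F(z+a_k) - F(z+b_k))$ cancel because both families have the same number of members and the
  same sum, and $\int \rho(u) F''(z+u)\,du$ remains (\<open>rho_second_difference\<close>). So
  \[(-1)^p \partial_z^{p-1} \log W_f(z) = p! \sum_m \int \rho(u) (z + \lambda_m + u)^{-(p+1)}\,du.\]

  Both integral representations are this sum over the zeros with sum and integral exchanged.
  Substituting $u = t - \lambda_m$ gives the integral with $\phi$ (\<open>stieltjes_phi\<close>). Writing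
  $p!\,w^{-(p+1)}$ as the Laplace transform of $s^p$, together with
  $g(s) = \int \rho(u) e^{-su}\,du$ (the Taylor formula again, for $F(u) = e^{-su}/s^2$), gives the
  integral with $h$ and $g$ (\<open>laplace_h_g\<close>). As $\rho$ has compact support in $[0,\infty)$, all
  exchanges are controlled by the convergent series $\sum_m (\Re z + \lambda_m)^{-(p+1)}$.

  Finally, $b \prec_w a$ makes $\rho$ non-negative (\<open>rho_nonneg\<close>), hence also $\phi$, so
  $p!\,\phi(t)\,dt$ is the measure of a generalised Stieltjes function of order $p+1$.
\<close>

section \<open>Exchanging an unordered sum and an integral\<close>

lemma has_sum_imp_sums_restrict:
  fixes u :: "nat \<Rightarrow> 'b::{comm_monoid_add, topological_space}"
  assumes "(u has_sum S) I"
  shows "(\<lambda>m. if m \<in> I then u m else 0) sums S"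
proof -
  have "((\<lambda>m. if m \<in> I then u m else 0) has_sum S) UNIV \<longleftrightarrow> (u has_sum S) I"
    by (rule has_sum_cong_neutral) auto
  with assms show ?thesis by (simp add: has_sum_imp_sums)
qed

lemma infsum_eq_suminf_restrict:
  fixes u :: "nat \<Rightarrow> 'b::banach"
  assumes "(\<lambda>m. norm (u m)) summable_on I"
  shows "summable (\<lambda>m. norm (if m \<in> I then u m else 0))"
    and "(\<Sum>\<^sub>\<infinity>m\<in>I. u m) = (\<Sum>m. if m \<in> I then u m else 0)"
proof -
  have "(\<lambda>m. if m \<in> I then norm (u m) else 0) sums (\<Sum>\<^sub>\<infinity>m\<in>I. norm (u m))"
    by (intro has_sum_imp_sums_restrict has_sum_infsum assms)
  moreover have "(\<lambda>m. if m \<in> I then norm (u m) else 0) = (\<lambda>m. norm (if m \<in> I then u m else 0))"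
    by auto
  ultimately show "summable (\<lambda>m. norm (if m \<in> I then u m else 0))"
    by (simp add: sums_iff)
  have "u summable_on I"
    using assms by (rule abs_summable_summable)
  from has_sum_imp_sums_restrict[OF has_sum_infsum[OF this]]
  show "(\<Sum>\<^sub>\<infinity>m\<in>I. u m) = (\<Sum>m. if m \<in> I then u m else 0)"
    by (simp add: sums_iff)
qed

text \<open>
  This is dominated convergence for series, transferred to sums over a set of natural numbers by
  extending the family by zero. Summability at every point makes the unordered sum and the series
  agree as functions, and not only almost everywhere.
\<close>
lemma
  fixes f :: "nat \<Rightarrow> 'a \<Rightarrow> 'b::{banach, second_countable_topology}"
  assumes int: "\<And>m. m \<in> I \<Longrightarrow> integrable M (f m)"
    and ptw: "\<And>x. (\<lambda>m. norm (f m x)) summable_on I"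
    and norms: "(\<lambda>m. \<integral>x. norm (f m x) \<partial>M) summable_on I"
  shows integrable_infsum: "integrable M (\<lambda>x. \<Sum>\<^sub>\<infinity>m\<in>I. f m x)"
    and integral_infsum: "(\<integral>x. (\<Sum>\<^sub>\<infinity>m\<in>I. f m x) \<partial>M) = (\<Sum>\<^sub>\<infinity>m\<in>I. \<integral>x. f m x \<partial>M)"
proof -
  define g where "g = (\<lambda>m x. if m \<in> I then f m x else 0)"
  have g_int: "integrable M (g m)" for m
    using int[of m] by (cases "m \<in> I") (auto simp: g_def)
  have g_ptw: "summable (\<lambda>m. norm (g m x))" for x
    unfolding g_def by (rule infsum_eq_suminf_restrict(1)[OF ptw])
  have eq: "(\<Sum>\<^sub>\<infinity>m\<in>I. f m x) = (\<Sum>m. g m x)" for x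
    unfolding g_def by (rule infsum_eq_suminf_restrict(2)[OF ptw])
  have g_norms: "summable (\<lambda>m. \<integral>x. norm (g m x) \<partial>M)"
  proof -
    have "summable (\<lambda>m. if m \<in> I then \<integral>x. norm (f m x) \<partial>M else 0)"
      using has_sum_imp_sums_restrict[OF has_sum_infsum[OF norms]] by (simp add: sums_iff)
    also have "(\<lambda>m. if m \<in> I then \<integral>x. norm (f m x) \<partial>M else 0) = (\<lambda>m. \<integral>x. norm (g m x) \<partial>M)"
      by (auto simp: g_def)
    finally show ?thesis .
  qed
  show "integrable M (\<lambda>x. \<Sum>\<^sub>\<infinity>m\<in>I. f m x)"
    unfolding eq by (intro integrable_suminf g_int AE_I2 g_ptw g_norms)
  have abs: "(\<lambda>m. norm (\<integral>x. f m x \<partial>M)) summable_on I"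
    by (rule Infinite_Sum.abs_summable_on_comparison_test'[OF norms]) (rule integral_norm_bound)
  have "(\<integral>x. (\<Sum>\<^sub>\<infinity>m\<in>I. f m x) \<partial>M) = (\<Sum>m. \<integral>x. g m x \<partial>M)"
    unfolding eq by (intro integral_suminf g_int AE_I2 g_ptw g_norms)
  also have "\<dots> = (\<Sum>m. if m \<in> I then \<integral>x. f m x \<partial>M else 0)"
    by (intro suminf_cong) (simp add: g_def)
  also have "\<dots> = (\<Sum>\<^sub>\<infinity>m\<in>I. \<integral>x. f m x \<partial>M)"
    by (rule infsum_eq_suminf_restrict(2)[OF abs, symmetric])
  finally show "(\<integral>x. (\<Sum>\<^sub>\<infinity>m\<in>I. f m x) \<partial>M) = (\<Sum>\<^sub>\<infinity>m\<in>I. \<integral>x. f m x \<partial>M)" .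
qed

section \<open>The Laplace transform of a power\<close>

text \<open>The modulus of the integrand is that of a Gamma integrand with the real rate $\Re w$.\<close>
lemma set_integrable_power_exp:
  fixes w :: complex
  assumes "Re w > 0"
  shows "set_integrable lborel {0<..} (\<lambda>s. of_real s ^ p * exp (- of_real s * w))"
proof -
  have "(\<lambda>s. complex_of_real s powr (of_nat (Suc p) - 1) / of_real (exp (Re w * s)))
          absolutely_integrable_on {0<..}"
    by (rule absolutely_integrable_Gamma_integral) (use assms in \<open>simp_all only: Re_complex_of_real of_nat_Suc, simp_all\<close>)
  hence "integrable lebesgue (\<lambda>s. norm (indicator {0<..} s *\<^sub>R
           (complex_of_real s powr (of_nat (Suc p) - 1) / of_real (exp (Re w * s)))))"
    unfolding set_integrable_def by (rule integrable_norm)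
  also have "(\<lambda>s. norm (indicator {0<..} s *\<^sub>R
           (complex_of_real s powr (of_nat (Suc p) - 1) / of_real (exp (Re w * s))))) =
         (\<lambda>s. norm (indicator {0<..} s *\<^sub>R (of_real s ^ p * exp (- of_real s * w))))"
    by (auto simp: fun_eq_iff indicator_def norm_mult norm_divide exp_minus field_simps
              norm_power powr_nat)
  finally have "integrable lborel
      (\<lambda>s. norm (indicator {0<..} s *\<^sub>R (of_real s ^ p * exp (- of_real s * w))))"
    by (subst (asm) integrable_completion) auto
  thus ?thesis
    unfolding set_integrable_def by (subst (asm) integrable_norm_iff) auto
qed

text \<open>
  The rate $w$ is complex, so a substitution reducing to the Gamma integral would have to rotate the
  path. Instead the recursion $J_{p+1} = \frac{p+1}{w} J_p$ comes from integrating the derivative of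
  $s^{p+1} e^{-sw}$, which vanishes at both ends.
\<close>
lemma laplace_power:
  fixes w :: complex
  assumes "Re w > 0"
  shows "(LINT s:{0<..}|lborel. of_real s ^ p * exp (- of_real s * w)) = fact p / w ^ (p + 1)"
proof -
  define J where "J = (\<lambda>p. LINT s:{0<..}|lborel. of_real s ^ p * exp (- of_real s * w))"
  note int = set_integrable_power_exp[OF assms]
  have [simp]: "w \<noteq> 0" using assms by auto
  have lim: "((\<lambda>s. of_real s ^ p * exp (- of_real s * w)) \<longlongrightarrow> 0) at_top" for p
  proof (rule tendsto_norm_zero_cancel)
    have "((\<lambda>s. s ^ p / exp (Re w * s)) \<longlongrightarrow> 0) at_top"
    proof -
      have "LIM s at_top. Re w * s :> at_top"
        by (rule filterlim_tendsto_pos_mult_at_top[OF tendsto_const assms filterlim_ident])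
      from filterlim_compose[OF tendsto_power_div_exp_0[of p] this]
      have "((\<lambda>s. (Re w * s) ^ p / exp (Re w * s)) \<longlongrightarrow> 0) at_top"
        by simp
      from tendsto_mult_right[OF this, of "1 / Re w ^ p"]
      have "((\<lambda>s. 1 / Re w ^ p * ((Re w * s) ^ p / exp (Re w * s))) \<longlongrightarrow> 0) at_top"
        by (simp add: mult_ac)
      thus ?thesis using assms by (simp add: power_mult_distrib)
    qed
    moreover have "eventually (\<lambda>s. s ^ p / exp (Re w * s) =
       norm (of_real s ^ p * exp (- of_real s * w))) at_top"
      using eventually_ge_at_top[of 0]
      by eventually_elim (simp add: norm_mult norm_power norm_inverse exp_minus divide_inverse mult_ac)
    ultimately show "((\<lambda>s. norm (of_real s ^ p * exp (- of_real s * w))) \<longlongrightarrow> 0) at_top"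
      by (rule Lim_transform_eventually)
  qed
  have FTC: "(LINT s:{0<..}|lborel. f s) = - A"
    if F: "\<And>s. s > 0 \<Longrightarrow> (F has_vector_derivative f s) (at s)"
      and cont: "continuous_on {0<..} f" and f: "set_integrable lborel {0<..} f"
      and A: "(F \<longlongrightarrow> A) (at_right 0)" and B: "(F \<longlongrightarrow> 0) at_top"
    for f F :: "real \<Rightarrow> complex" and A
  proof -
    have "(LBINT s=ereal 0..\<infinity>. f s) = 0 - A"
    proof (rule interval_integral_FTC_integrable)
      show "isCont f s" if "ereal 0 < ereal s" for s
        using cont that by (auto simp: continuous_on_eq_continuous_at)
      show "((F \<circ> real_of_ereal) \<longlongrightarrow> A) (at_right (ereal 0))"
        unfolding ereal_tendsto_simps by (rule A)
      show "((F \<circ> real_of_ereal) \<longlongrightarrow> 0) (at_left \<infinity>)"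
        unfolding ereal_tendsto_simps by (rule B)
    qed (use F f in auto)
    thus ?thesis by (simp add: interval_integral_to_infinity_eq)
  qed
  have J0: "J 0 = 1 / w"
  proof -
    have "J 0 = - (- 1 / w)"
      unfolding J_def
    proof (rule FTC[where F = "\<lambda>s. - exp (- of_real s * w) / w"])
      show "((\<lambda>s. - exp (- of_real s * w) / w) \<longlongrightarrow> 0) at_top"
        using tendsto_mult_right[OF lim[of 0], of "-1/w"] by simp
      show "((\<lambda>s. - exp (- of_real s * w) / w) has_vector_derivative
              of_real s ^ 0 * exp (- of_real s * w)) (at s)" for s
      proof -
        have "((\<lambda>s. - exp (- s * w) / w) has_field_derivative exp (- of_real s * w)) (at (of_real s))"
          by (auto intro!: derivative_eq_intros)
        from has_vector_derivative_real_field[OF this] show ?thesis by simp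
      qed
      have "((\<lambda>s. - exp (- of_real s * w) / w) \<longlongrightarrow> - exp (- of_real 0 * w) / w) (at_right 0)"
        by (intro tendsto_intros) auto
      thus "((\<lambda>s. - exp (- of_real s * w) / w) \<longlongrightarrow> - 1 / w) (at_right 0)"
        by simp
    qed (auto intro!: continuous_intros int[of 0, simplified])
    thus ?thesis by simp
  qed
  have JS: "J (Suc p) = of_nat (Suc p) / w * J p" for p
  proof -
    let ?f = "\<lambda>p s. of_real s ^ p * exp (- of_real s * w)"
    have "(LINT s:{0<..}|lborel. of_nat (Suc p) * ?f p s - w * ?f (Suc p) s) = - 0"
    proof (rule FTC[where F = "?f (Suc p)"])
      show "(?f (Suc p) \<longlongrightarrow> 0) at_top" by (rule lim)
      show "(?f (Suc p) has_vector_derivative of_nat (Suc p) * ?f p s - w * ?f (Suc p) s) (at s)" for s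
      proof -
        have "((\<lambda>s. s ^ Suc p * exp (- s * w)) has_field_derivative
                of_nat (Suc p) * ?f p s - w * ?f (Suc p) s) (at (of_real s))"
          by (rule derivative_eq_intros refl)+ (simp add: algebra_simps)
        from has_vector_derivative_real_field[OF this] show ?thesis .
      qed
      have "(?f (Suc p) \<longlongrightarrow> ?f (Suc p) 0) (at_right 0)"
        by (intro tendsto_intros)
      thus "(?f (Suc p) \<longlongrightarrow> 0) (at_right 0)"
        by simp
      show "set_integrable lborel {0<..} (\<lambda>s. of_nat (Suc p) * ?f p s - w * ?f (Suc p) s)"
        by (intro set_integral_diff set_integrable_mult_right int)
    qed (auto intro!: continuous_intros)
    moreover have "(LINT s:{0<..}|lborel. of_nat (Suc p) * ?f p s - w * ?f (Suc p) s) =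
       of_nat (Suc p) * J p - w * J (Suc p)"
      unfolding J_def
      using set_integral_diff(2)[OF set_integrable_mult_right[OF int[of p], of "of_nat (Suc p)"]
          set_integrable_mult_right[OF int[of "Suc p"], of w]]
      by (simp only: set_integral_mult_right simp_thms)
    ultimately show ?thesis by (simp add: field_simps)
  qed
  have "J p = fact p / w ^ (p + 1)"
  proof (induction p)
    case (Suc p)
    show ?case unfolding JS Suc.IH by (simp add: field_simps)
  qed (simp add: J0)
  thus ?thesis by (simp add: J_def)
qed

section \<open>The kernel of the Taylor formula\<close>

lemma rho_eq_sum_max: "rho n a b t = (\<Sum>k=1..n. max 0 (t - a k) - max 0 (t - b k))"
proof -
  have "(t - c) * indicator {c..} t = max 0 (t - c)" for c :: real
    by (auto simp: indicator_def)
  thus ?thesis by (simp add: rho_def sum_subtractf)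
qed

lemma continuous_on_rho [continuous_intros]:
  "continuous_on A f \<Longrightarrow> continuous_on A (\<lambda>x. rho n a b (f x))"
  unfolding rho_eq_sum_max by (intro continuous_intros)

lemma borel_measurable_rho [measurable]: "rho n a b \<in> borel_measurable borel"
  by (intro borel_measurable_continuous_onI continuous_intros)

locale balanced_shifts =
  fixes n :: nat and a b :: "nat \<Rightarrow> real"
  assumes a_nonneg: "k \<in> {1..n} \<Longrightarrow> 0 \<le> a k"
    and b_nonneg: "k \<in> {1..n} \<Longrightarrow> 0 \<le> b k"
    and sum_eq: "(\<Sum>k=1..n. a k) = (\<Sum>k=1..n. b k)"
begin

text \<open>As the shifts are non-negative, their sum bounds each of them.\<close>
definition total :: real where "total = (\<Sum>k=1..n. a k)"

lemma a_le_total: "k \<in> {1..n} \<Longrightarrow> a k \<le> total"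
  unfolding total_def by (rule member_le_sum) (auto intro: a_nonneg)

lemma b_le_total: "k \<in> {1..n} \<Longrightarrow> b k \<le> total"
  unfolding total_def sum_eq using member_le_sum[of k "{1..n}" b] b_nonneg by auto

text \<open>
  To the right of all shifts $\rho$ is the constant $\sum_k (b_k - a_k)$, so it is the equality of the
  two sums that makes the support compact.
\<close>
lemma rho_eq_0: "t \<le> 0 \<or> t \<ge> total \<Longrightarrow> rho n a b t = 0"
proof (elim disjE)
  assume "t \<le> 0"
  thus ?thesis
    unfolding rho_eq_sum_max using a_nonneg b_nonneg
    by (intro sum.neutral ballI) (smt (verit))
next
  assume t: "t \<ge> total"
  have "rho n a b t = (\<Sum>k=1..n. (t - a k) - (t - b k))"
    unfolding rho_eq_sum_max
    by (intro sum.cong refl) (use a_le_total b_le_total t in fastforce)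
  thus ?thesis unfolding sum_subtractf sum_eq by simp
qed

lemma integrable_rho: "integrable lborel (rho n a b)"
proof -
  have "integrable lborel (\<lambda>t. indicator {0..total} t *\<^sub>R rho n a b t)"
    by (rule borel_integrable_compact) (auto intro!: continuous_intros)
  also have "(\<lambda>t. indicator {0..total} t *\<^sub>R rho n a b t) = rho n a b"
  proof
    fix t show "indicator {0..total} t *\<^sub>R rho n a b t = rho n a b t"
      using rho_eq_0[of t] by (cases "0 \<le> t \<and> t \<le> total") (auto simp: indicator_def)
  qed
  finally show ?thesis .
qed

text \<open>
  Each summand $(u-c)_+$ of $\rho$ contributes $F(c)$ together with boundary terms at the right end
  \<open>total\<close> of the support. These are affine in $c$ and cancel in the difference.
\<close>
lemma rho_second_difference:
  fixes F F' F'' :: "real \<Rightarrow> 'e::euclidean_space"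
  assumes F: "\<And>u. u \<ge> 0 \<Longrightarrow> (F has_vector_derivative F' u) (at u)"
    and F': "\<And>u. u \<ge> 0 \<Longrightarrow> (F' has_vector_derivative F'' u) (at u)"
    and cont: "continuous_on {0..} F''"
  shows "has_bochner_integral lborel (\<lambda>u. rho n a b u *\<^sub>R F'' u) (\<Sum>k=1..n. F (a k) - F (b k))"
proof -
  have ramp: "has_bochner_integral lborel (\<lambda>u. indicator {0..total} u *\<^sub>R (max 0 (u - c) *\<^sub>R F'' u))
      ((total - c) *\<^sub>R F' total - F total + F c)" if c: "0 \<le> c" "c \<le> total" for c
  proof -
    have "has_bochner_integral lborel (\<lambda>u. indicator {c..total} u *\<^sub>R ((u - c) *\<^sub>R F'' u))
       (((total - c) *\<^sub>R F' total - F total) - ((c - c) *\<^sub>R F' c - F c))"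
    proof (rule has_bochner_integral_FTC_Icc)
      fix u assume u: "c \<le> u" "u \<le> total"
      show "((\<lambda>u. (u - c) *\<^sub>R F' u - F u) has_vector_derivative (u - c) *\<^sub>R F'' u) (at u within {c..total})"
      proof -
        have "u \<ge> 0" using c u by simp
        have "((\<lambda>u. u - c) has_field_derivative 1) (at u within {c..total})"
          by (auto intro!: derivative_eq_intros)
        from has_vector_derivative_diff[OF has_vector_derivative_scaleR[OF this
               has_vector_derivative_at_within[OF F'[OF \<open>u \<ge> 0\<close>]]]
             has_vector_derivative_at_within[OF F[OF \<open>u \<ge> 0\<close>]]]
        show ?thesis by simp
      qed
    next
      show "continuous_on {c..total} (\<lambda>u. (u - c) *\<^sub>R F'' u)"
        by (intro continuous_intros continuous_on_subset[OF cont]) (use c in auto)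
    qed (use c in auto)
    also have "(\<lambda>u. indicator {c..total} u *\<^sub>R ((u - c) *\<^sub>R F'' u)) =
        (\<lambda>u. indicator {0..total} u *\<^sub>R (max 0 (u - c) *\<^sub>R F'' u))"
      using c by (auto simp: fun_eq_iff indicator_def)
    finally show ?thesis by simp
  qed
  have "has_bochner_integral lborel
      (\<lambda>u. \<Sum>k=1..n. indicator {0..total} u *\<^sub>R (max 0 (u - a k) *\<^sub>R F'' u)
                  - indicator {0..total} u *\<^sub>R (max 0 (u - b k) *\<^sub>R F'' u))
      (\<Sum>k=1..n. ((total - a k) *\<^sub>R F' total - F total + F (a k)) - ((total - b k) *\<^sub>R F' total - F total + F (b k)))"
    by (intro has_bochner_integral_sum has_bochner_integral_diff ramp a_nonneg b_nonneg a_le_total b_le_total)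
  also have "(\<Sum>k=1..n. ((total - a k) *\<^sub>R F' total - F total + F (a k)) - ((total - b k) *\<^sub>R F' total - F total + F (b k)))
      = (\<Sum>k=1..n. b k - a k) *\<^sub>R F' total + (\<Sum>k=1..n. F (a k) - F (b k))"
    by (simp add: scaleR_left.sum sum.distrib[symmetric] algebra_simps)
  also have "(\<Sum>k=1..n. b k - a k) = 0"
    unfolding sum_subtractf sum_eq by simp
  also have "(\<lambda>u. \<Sum>k=1..n. indicator {0..total} u *\<^sub>R (max 0 (u - a k) *\<^sub>R F'' u)
                  - indicator {0..total} u *\<^sub>R (max 0 (u - b k) *\<^sub>R F'' u)) =
             (\<lambda>u. rho n a b u *\<^sub>R F'' u)"
  proof
    fix u
    have "(\<Sum>k=1..n. indicator {0..total} u *\<^sub>R (max 0 (u - a k) *\<^sub>R F'' u)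
                  - indicator {0..total} u *\<^sub>R (max 0 (u - b k) *\<^sub>R F'' u)) =
          indicator {0..total} u *\<^sub>R (rho n a b u *\<^sub>R F'' u)"
      by (simp add: rho_eq_sum_max scaleR_left.sum scaleR_sum_right scaleR_left_diff_distrib
            scaleR_right_diff_distrib)
    also have "\<dots> = rho n a b u *\<^sub>R F'' u"
      using rho_eq_0[of u] by (cases "0 \<le> u \<and> u \<le> total") (auto simp: indicator_def)
    finally show "(\<Sum>k=1..n. indicator {0..total} u *\<^sub>R (max 0 (u - a k) *\<^sub>R F'' u)
                  - indicator {0..total} u *\<^sub>R (max 0 (u - b k) *\<^sub>R F'' u)) = rho n a b u *\<^sub>R F'' u" .
  qed
  finally show ?thesis by simp
qed

text \<open>This is the Taylor formula for $F(u) = e^{-su}/s^2$, whose second derivative is $e^{-su}$.\<close>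
lemma g_fun_eq_laplace_rho:
  assumes "s > 0"
  shows "has_bochner_integral lborel (\<lambda>u. rho n a b u * exp (- s * u)) (g_fun n a b s)"
proof -
  have "has_bochner_integral lborel (\<lambda>u. rho n a b u *\<^sub>R exp (- s * u))
      (\<Sum>k=1..n. exp (- s * a k) / s\<^sup>2 - exp (- s * b k) / s\<^sup>2)"
  proof (rule rho_second_difference)
    fix u :: real
    show "((\<lambda>u. exp (- s * u) / s\<^sup>2) has_vector_derivative - exp (- s * u) / s) (at u)"
      unfolding has_real_derivative_iff_has_vector_derivative[symmetric]
      by (rule derivative_eq_intros refl)+ (use assms in \<open>auto simp: power2_eq_square\<close>)
    show "((\<lambda>u. - exp (- s * u) / s) has_vector_derivative exp (- s * u)) (at u)"
      unfolding has_real_derivative_iff_has_vector_derivative[symmetric]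
      by (rule derivative_eq_intros refl)+ (use assms in auto)
  qed (auto intro!: continuous_intros)
  thus ?thesis
    by (simp add: g_fun_def sum_divide_distrib sum_subtractf diff_divide_distrib)
qed

definition rho_mass :: real where "rho_mass = (\<integral>u. \<bar>rho n a b u\<bar> \<partial>lborel)"

text \<open>
  A bound for $u \ge 0$ suffices, as $\rho$ vanishes on the negative half-line, where the kernels
  $(w+u)^{-(p+1)}$ may have a pole.
\<close>
lemma integrable_rho_mult:
  fixes k :: "real \<Rightarrow> complex"
  assumes [measurable]: "k \<in> borel_measurable borel" and k: "\<And>u. u \<ge> 0 \<Longrightarrow> norm (k u) \<le> B"
  shows "integrable lborel (\<lambda>u. of_real (rho n a b u) * k u)"
    and "(\<integral>u. norm (of_real (rho n a b u) * k u) \<partial>lborel) \<le> B * rho_mass"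
    and "norm (\<integral>u. of_real (rho n a b u) * k u \<partial>lborel) \<le> B * rho_mass"
proof -
  have le: "norm (of_real (rho n a b u) * k u) \<le> B * \<bar>rho n a b u\<bar>" for u
  proof (cases "u \<ge> 0")
    case True
    thus ?thesis using mult_left_mono[OF k[OF True], of "\<bar>rho n a b u\<bar>"]
      by (simp add: norm_mult mult_ac)
  qed (simp add: rho_eq_0)
  have int: "integrable lborel (\<lambda>u. B * \<bar>rho n a b u\<bar>)"
    by (intro integrable_mult_right integrable_abs integrable_rho)
  show *: "integrable lborel (\<lambda>u. of_real (rho n a b u) * k u)"
    by (rule Bochner_Integration.integrable_bound[OF int]) (use le in \<open>auto intro!: AE_I2 order_trans[OF le abs_ge_self]\<close>)
  have "(\<integral>u. norm (of_real (rho n a b u) * k u) \<partial>lborel) \<le> (\<integral>u. B * \<bar>rho n a b u\<bar> \<partial>lborel)"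
    by (rule integral_mono[OF integrable_norm[OF *] int le])
  also have "\<dots> = B * rho_mass" by (simp add: rho_mass_def)
  finally show **: "(\<integral>u. norm (of_real (rho n a b u) * k u) \<partial>lborel) \<le> B * rho_mass" .
  show "norm (\<integral>u. of_real (rho n a b u) * k u \<partial>lborel) \<le> B * rho_mass"
    by (rule order_trans[OF integral_norm_bound **])
qed

lemma abs_g_fun_le:
  assumes "s > 0"
  shows "\<bar>g_fun n a b s\<bar> \<le> rho_mass"
proof -
  have "\<bar>g_fun n a b s\<bar> \<le> (\<integral>u. \<bar>rho n a b u * exp (- s * u)\<bar> \<partial>lborel)"
    using g_fun_eq_laplace_rho[OF assms] integral_norm_bound[of lborel "\<lambda>u. rho n a b u * exp (- s * u)"]
    by (simp add: has_bochner_integral_iff)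
  also have "\<dots> \<le> rho_mass"
    unfolding rho_mass_def
  proof (rule integral_mono)
    show "integrable lborel (\<lambda>u. \<bar>rho n a b u * exp (- s * u)\<bar>)"
      using g_fun_eq_laplace_rho[OF assms] by (intro integrable_abs) (simp add: has_bochner_integral_iff)
    show "integrable lborel (\<lambda>u. \<bar>rho n a b u\<bar>)"
      by (intro integrable_abs integrable_rho)
    show "\<bar>rho n a b u * exp (- s * u)\<bar> \<le> \<bar>rho n a b u\<bar>" for u
    proof (cases "u \<ge> 0")
      case True
      hence "exp (- s * u) \<le> 1" using assms by simp
      from mult_left_mono[OF this, of "\<bar>rho n a b u\<bar>"] show ?thesis
        by (simp only: abs_mult abs_exp_cancel) simp
    qed (simp add: rho_eq_0)
  qed
  finally show ?thesis .
qed

text \<open>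
  Insert $g(s) = \int \rho(u) e^{-su}\,du$ and integrate over $s$ first: the inner integral is the
  Laplace transform of $s^p$ at $w + u$. The estimate of the $L^1$ norm is what later allows the sum
  over the zeros.
\<close>
lemma laplace_g_fun:
  fixes w :: complex and p :: nat
  assumes w: "Re w > 0"
  defines "K \<equiv> (\<lambda>s. indicator {0<..} s *\<^sub>R (exp (- of_real s * w) * of_real (s ^ p * g_fun n a b s)))"
  shows "integrable lborel K"
    and "(\<integral>s. K s \<partial>lborel) = fact p * (\<integral>u. of_real (rho n a b u) / (w + of_real u) ^ (p + 1) \<partial>lborel)"
    and "(\<integral>s. norm (K s) \<partial>lborel) \<le> fact p / Re w ^ (p + 1) * rho_mass"
proof -
  define k :: "real \<Rightarrow> real \<Rightarrow> complex" where
    "k = (\<lambda>u s. of_real (rho n a b u) * (indicator {0<..} s *\<^sub>R (of_real s ^ p * exp (- of_real s * (w + of_real u)))))"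
  have inner: "(\<integral>s. k u s \<partial>lborel) = fact p * (of_real (rho n a b u) / (w + of_real u) ^ (p + 1))" for u
  proof (cases "u \<ge> 0")
    case True
    have "(\<integral>s. k u s \<partial>lborel) = of_real (rho n a b u) *
        (LINT s:{0<..}|lborel. of_real s ^ p * exp (- of_real s * (w + of_real u)))"
      unfolding k_def set_lebesgue_integral_def by (rule integral_mult_right_zero)
    also have "\<dots> = of_real (rho n a b u) * (fact p / (w + of_real u) ^ (p + 1))"
      by (subst laplace_power) (use True w in auto)
    finally show ?thesis by simp
  qed (simp add: k_def rho_eq_0)
  have inner': "integrable lborel (k u)" for u
  proof (cases "u \<ge> 0")
    case True
    thus ?thesis using set_integrable_power_exp[of "w + of_real u" p] w
      unfolding set_integrable_def k_def by (intro integrable_mult_right) auto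
  qed (simp add: k_def rho_eq_0)
  have norm_k: "norm (k u s) = \<bar>rho n a b u\<bar> * (indicator {0<..} s *\<^sub>R (s ^ p * exp (- s * (Re w + u))))"
    for u s by (auto simp: k_def norm_mult norm_power indicator_def)
  have real_int: "(\<integral>s. indicator {0<..} s *\<^sub>R (s ^ p * exp (- s * x)) \<partial>lborel) = fact p / x ^ (p + 1)"
    and real_int': "integrable lborel (\<lambda>s. indicator {0<..} s *\<^sub>R (s ^ p * exp (- s * x)))"
    if "x > 0" for x :: real
  proof -
    have *: "(\<lambda>s. complex_of_real (indicator {0<..} s *\<^sub>R (s ^ p * exp (- s * x)))) =
        (\<lambda>s. indicator {0<..} s *\<^sub>R (of_real s ^ p * exp (- of_real s * of_real x)))"
      by (auto simp: indicator_def fun_eq_iff exp_of_real[symmetric])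
    have "complex_of_real (\<integral>s. indicator {0<..} s *\<^sub>R (s ^ p * exp (- s * x)) \<partial>lborel) =
        (\<integral>s. indicator {0<..} s *\<^sub>R (of_real s ^ p * exp (- of_real s * of_real x)) \<partial>lborel)"
      unfolding *[symmetric] by (rule integral_complex_of_real[symmetric])
    also have "\<dots> = of_real (fact p / x ^ (p + 1))"
      using laplace_power[of "of_real x" p] that by (simp add: set_lebesgue_integral_def)
    finally show "(\<integral>s. indicator {0<..} s *\<^sub>R (s ^ p * exp (- s * x)) \<partial>lborel) = fact p / x ^ (p + 1)"
      by (simp only: of_real_eq_iff)
    have "integrable lborel (\<lambda>s. complex_of_real (indicator {0<..} s *\<^sub>R (s ^ p * exp (- s * x))))"
      unfolding * using set_integrable_power_exp[of "of_real x" p] that by (simp add: set_integrable_def)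
    thus "integrable lborel (\<lambda>s. indicator {0<..} s *\<^sub>R (s ^ p * exp (- s * x)))"
      by (simp only: complex_of_real_integrable_eq)
  qed
  \<comment> \<open>With \<open>\<bar>u\<bar>\<close> in place of \<open>u\<close> the denominator stays positive for negative \<open>u\<close>, where \<open>rho\<close> vanishes.\<close>
  have norms: "integrable lborel (\<lambda>u. \<integral>s. norm (k u s) \<partial>lborel)"
  proof -
    have "integrable lborel (\<lambda>u. of_real (rho n a b u) * complex_of_real (fact p / (Re w + \<bar>u\<bar>) ^ (p + 1)))"
    proof (rule integrable_rho_mult(1))
      fix u :: real
      have "fact p / (Re w + \<bar>u\<bar>) ^ (p + 1) \<le> (fact p :: real) / Re w ^ (p + 1)"
        using w by (intro divide_left_mono power_mono mult_pos_pos zero_less_power) auto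
      thus "norm (complex_of_real (fact p / (Re w + \<bar>u\<bar>) ^ (p + 1))) \<le> fact p / Re w ^ (p + 1)"
        using w by (simp only: norm_of_real) simp
    qed auto
    hence "integrable lborel (\<lambda>u. norm (of_real (rho n a b u) * complex_of_real (fact p / (Re w + \<bar>u\<bar>) ^ (p + 1))))"
      by (rule integrable_norm)
    also have "(\<lambda>u. norm (of_real (rho n a b u) * complex_of_real (fact p / (Re w + \<bar>u\<bar>) ^ (p + 1))))
      = (\<lambda>u. \<integral>s. norm (k u s) \<partial>lborel)"
    proof
      fix u
      show "norm (of_real (rho n a b u) * complex_of_real (fact p / (Re w + \<bar>u\<bar>) ^ (p + 1)))
        = (\<integral>s. norm (k u s) \<partial>lborel)"
      proof (cases "u \<ge> 0")
        case True
        have "(\<integral>s. norm (k u s) \<partial>lborel) = \<bar>rho n a b u\<bar> * (fact p / (Re w + u) ^ (p + 1))"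
          unfolding norm_k integral_mult_right_zero by (subst real_int) (use True w in auto)
        moreover have "\<bar>fact p / (Re w + \<bar>u\<bar>) ^ (p + 1)\<bar> = (fact p :: real) / (Re w + u) ^ (p + 1)"
          using True w by simp
        ultimately show ?thesis
          by (simp only: norm_mult norm_of_real)
      qed (simp add: norm_k rho_eq_0)
    qed
    finally show ?thesis .
  qed
  have prod: "integrable (lborel \<Otimes>\<^sub>M lborel) (case_prod k)"
    by (rule lborel_pair.Fubini_integrable) (use norms inner' in \<open>auto simp: k_def\<close>)
  have outer: "(\<integral>u. k u s \<partial>lborel) = K s" for s
  proof (cases "s > 0")
    case True
    have split: "exp (- of_real s * (w + of_real u)) = exp (- of_real s * w) * of_real (exp (- s * u))"
      for u
    proof -
      have "- of_real s * (w + of_real u) = - of_real s * w + of_real (- s * u)"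
        by (simp add: algebra_simps)
      thus ?thesis by (simp only: exp_add exp_of_real)
    qed
    have "(\<integral>u. k u s \<partial>lborel) =
       (\<integral>u. (exp (- of_real s * w) * of_real s ^ p) * of_real (rho n a b u * exp (- s * u)) \<partial>lborel)"
      using True unfolding k_def split
      by (intro Bochner_Integration.integral_cong refl) (simp add: mult_ac)
    also have "\<dots> = (exp (- of_real s * w) * of_real s ^ p) * of_real (g_fun n a b s)"
      using g_fun_eq_laplace_rho[OF True]
      unfolding integral_mult_right_zero integral_complex_of_real has_bochner_integral_iff by simp
    also have "\<dots> = K s" using True by (simp add: K_def)
    finally show ?thesis .
  qed (simp add: k_def K_def)
  show K_int: "integrable lborel K"
    using lborel_pair.integrable_snd[OF prod] by (simp add: outer)
  have "(\<integral>s. K s \<partial>lborel) = (\<integral>s. (\<integral>u. k u s \<partial>lborel) \<partial>lborel)"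
    by (simp only: outer)
  also have "\<dots> = (\<integral>u. (\<integral>s. k u s \<partial>lborel) \<partial>lborel)"
    by (rule lborel_pair.Fubini_integral[OF prod])
  finally show "(\<integral>s. K s \<partial>lborel) = fact p * (\<integral>u. of_real (rho n a b u) / (w + of_real u) ^ (p + 1) \<partial>lborel)"
    by (simp only: inner integral_mult_right_zero)
  have "(\<integral>s. norm (K s) \<partial>lborel) \<le> (\<integral>s. indicator {0<..} s *\<^sub>R (s ^ p * exp (- s * Re w)) * rho_mass \<partial>lborel)"
  proof (rule integral_mono)
    show "integrable lborel (\<lambda>s. norm (K s))"
      by (rule integrable_norm[OF K_int])
    show "integrable lborel (\<lambda>s. indicator {0<..} s *\<^sub>R (s ^ p * exp (- s * Re w)) * rho_mass)"
      by (rule integrable_mult_left) (rule real_int'[OF w])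
    fix s :: real
    show "norm (K s) \<le> indicator {0<..} s *\<^sub>R (s ^ p * exp (- s * Re w)) * rho_mass"
    proof (cases "s > 0")
      case True
      have "norm (K s) = (s ^ p * exp (- s * Re w)) * \<bar>g_fun n a b s\<bar>"
        using True by (simp add: K_def norm_mult norm_power mult_ac)
      also have "\<dots> \<le> (s ^ p * exp (- s * Re w)) * rho_mass"
        using True by (intro mult_left_mono abs_g_fun_le) auto
      finally show ?thesis using True by simp
    qed (simp add: K_def)
  qed
  thus "(\<integral>s. norm (K s) \<partial>lborel) \<le> fact p / Re w ^ (p + 1) * rho_mass"
    by (simp only: integral_mult_left_zero real_int[OF w])
qed

text \<open>
  As $b$ is non-decreasing, the indices with $b_k \le t$ form an initial segment $\{1,\dots,m\}$, on
  which majorisation compares the sums: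
  $\sum_k (t-b_k)_+ = \sum_{k\le m} (t-b_k) \le \sum_{k\le m} (t-a_k) \le \sum_k (t-a_k)_+$.
\<close>
lemma rho_nonneg:
  assumes b: "mono_on {1..n} b" and maj: "weak_supermajorised n b a"
  shows "rho n a b t \<ge> 0"
proof -
  define S where "S = {k\<in>{1..n}. b k \<le> t}"
  have down: "j \<in> S" if "k \<in> S" "1 \<le> j" "j \<le> k" for j k
    using that mono_onD[OF b, of j k] by (auto simp: S_def)
  obtain m where m: "S = {1..m}" and "m \<le> n"
  proof (cases "S = {}")
    case True
    thus ?thesis by (intro that[of 0]) auto
  next
    case False
    have fin: "finite S" by (simp add: S_def)
    have Max: "Max S \<in> S" using Max_in[OF fin False] .
    have sub: "S \<subseteq> {1..n}" by (auto simp: S_def)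
    show ?thesis
    proof (rule that[of "Max S"])
      show "S = {1..Max S}"
      proof (intro equalityI subsetI)
        fix k assume "k \<in> S"
        thus "k \<in> {1..Max S}" using Max_ge[OF fin] sub by auto
      next
        fix k assume "k \<in> {1..Max S}"
        thus "k \<in> S" using down[OF Max, of k] by auto
      qed
      show "Max S \<le> n" using Max sub by auto
    qed
  qed
  have S_iff: "b k \<le> t \<longleftrightarrow> k \<le> m" if "k \<in> {1..n}" for k
    using that m by (auto simp: S_def set_eq_iff)
  have le: "(\<Sum>k=1..m. a k) \<le> (\<Sum>k=1..m. b k)"
    using maj \<open>m \<le> n\<close> by (cases "m = 0") (auto simp: weak_supermajorised_def)
  have "(\<Sum>k=1..n. max 0 (t - b k)) = (\<Sum>k=1..m. max 0 (t - b k))"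
    by (intro sum.mono_neutral_right ballI) (use \<open>m \<le> n\<close> S_iff in fastforce)+
  also have "\<dots> = (\<Sum>k=1..m. t - b k)"
    by (intro sum.cong refl) (use \<open>m \<le> n\<close> S_iff in fastforce)
  also have "\<dots> \<le> (\<Sum>k=1..m. t - a k)"
    using le by (simp add: sum_subtractf)
  also have "\<dots> \<le> (\<Sum>k=1..m. max 0 (t - a k))"
    by (intro sum_mono) auto
  also have "\<dots> \<le> (\<Sum>k=1..n. max 0 (t - a k))"
    using \<open>m \<le> n\<close> by (intro sum_mono2) auto
  finally show ?thesis by (simp add: rho_eq_sum_max sum_subtractf)
qed

end

section \<open>Higher derivatives of logarithmic derivatives\<close>

lemma higher_deriv_poly_eq_0:
  fixes Q :: "complex poly"
  assumes "Q = 0 \<or> degree Q < p"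
  shows "(deriv ^^ p) (poly Q) z = 0"
  using assms
proof (induction p arbitrary: Q)
  case (Suc p)
  have "deriv (poly Q) = poly (pderiv Q)"
    by (intro ext DERIV_imp_deriv poly_DERIV)
  moreover have "pderiv Q = 0 \<or> degree (pderiv Q) < p"
    using Suc.prems by (cases "degree Q = 0") (auto simp: pderiv_eq_0_iff degree_pderiv)
  ultimately show ?case
    using Suc.IH[of "pderiv Q"] by (simp only: funpow_Suc_right o_apply)
qed auto

lemma higher_deriv_inverse_linear:
  fixes c z :: complex
  assumes "z \<noteq> c"
  shows "(deriv ^^ p) (\<lambda>z. 1 / (z - c)) z = (-1) ^ p * fact p / (z - c) ^ (p + 1)"
  using assms
proof (induction p arbitrary: z)
  case (Suc p)
  have "deriv ((deriv ^^ p) (\<lambda>z. 1 / (z - c))) z = deriv (\<lambda>z. (-1) ^ p * fact p / (z - c) ^ (p + 1)) z"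
  proof (rule deriv_cong_ev)
    have "eventually (\<lambda>z. z \<in> - {c}) (nhds z)"
      using Suc.prems by (intro eventually_nhds_in_open) auto
    thus "eventually (\<lambda>z. (deriv ^^ p) (\<lambda>z. 1 / (z - c)) z = (-1) ^ p * fact p / (z - c) ^ (p + 1)) (nhds z)"
      by eventually_elim (use Suc.IH in auto)
  qed auto
  also have "\<dots> = (-1) ^ Suc p * fact (Suc p) / (z - c) ^ (Suc p + 1)"
  proof (rule DERIV_imp_deriv)
    have "((\<lambda>z. (-1) ^ p * fact p * inverse ((z - c) ^ (p + 1))) has_field_derivative
        (-1) ^ p * fact p * (- (inverse ((z - c) ^ (p + 1)) * (of_nat (p + 1) * (z - c) ^ p) * inverse ((z - c) ^ (p + 1))))) (at z)"
      by (rule derivative_eq_intros refl | use Suc.prems in simp)+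
    also have "(-1) ^ p * fact p * (- (inverse ((z - c) ^ (p + 1)) * (of_nat (p + 1) * (z - c) ^ p) * inverse ((z - c) ^ (p + 1))))
      = (-1) ^ Suc p * fact (Suc p) / (z - c) ^ (Suc p + 1)"
      using Suc.prems by (simp add: divide_simps)
    finally show "((\<lambda>z. (-1) ^ p * fact p / (z - c) ^ (p + 1)) has_field_derivative
        (-1) ^ Suc p * fact (Suc p) / (z - c) ^ (Suc p + 1)) (at z)"
      by (simp only: divide_inverse)
  qed
  finally show ?case by simp
qed simp

lemma higher_deriv_sum:
  fixes f :: "'i \<Rightarrow> complex \<Rightarrow> complex"
  assumes "finite A" "\<And>i. i \<in> A \<Longrightarrow> f i holomorphic_on S" "open S" "z \<in> S"
  shows "(deriv ^^ p) (\<lambda>z. \<Sum>i\<in>A. f i z) z = (\<Sum>i\<in>A. (deriv ^^ p) (f i) z)"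
  using assms(1,2)
proof (induction A rule: finite_induct)
  case (insert i A)
  have "(deriv ^^ p) (\<lambda>z. f i z + (\<Sum>i\<in>A. f i z)) z =
      (deriv ^^ p) (f i) z + (deriv ^^ p) (\<lambda>z. \<Sum>i\<in>A. f i z) z"
    by (rule higher_deriv_add[where S = S]) (use assms insert in \<open>auto intro!: holomorphic_intros\<close>)
  thus ?case using insert by simp
qed (simp add: higher_deriv_const)

text \<open>The geometric sum splits off the polynomial part, of degree below $r$.\<close>
lemma power_over_linear_eq:
  fixes z w :: complex
  assumes "w \<noteq> 0" "z \<noteq> w"
  shows "(z / w) ^ r / (z - w) = 1 / (z - w) + poly (\<Sum>j<r. monom (1 / w ^ (j + 1)) j) z"
proof -
  have "(z / w) ^ r = 1 + (z / w - 1) * (\<Sum>j<r. (z / w) ^ j)"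
    unfolding power_diff_1_eq[symmetric] by simp
  also have "z / w - 1 = (z - w) / w"
    using assms by (simp add: field_simps)
  finally have "(z / w) ^ r / (z - w) = 1 / (z - w) + (1 / w) * (\<Sum>j<r. (z / w) ^ j)"
    using assms by (simp add: add_divide_distrib)
  also have "(1 / w) * (\<Sum>j<r. (z / w) ^ j) = poly (\<Sum>j<r. monom (1 / w ^ (j + 1)) j) z"
    by (simp add: poly_sum poly_monom sum_distrib_left power_divide)
  finally show ?thesis .
qed

lemma higher_deriv_power_over_linear:
  fixes z w :: complex
  assumes "w \<noteq> 0" "z \<noteq> w" "r \<le> p"
  shows "(deriv ^^ p) (\<lambda>z. (z / w) ^ r / (z - w)) z = (-1) ^ p * fact p / (z - w) ^ (p + 1)"
proof -
  let ?Q = "\<Sum>j<r. monom (1 / w ^ (j + 1)) j"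
  have Q: "?Q = 0 \<or> degree ?Q < p"
  proof (cases "r = 0")
    case False
    have "degree ?Q \<le> r - 1"
      by (intro degree_sum_le) (auto intro!: order_trans[OF degree_monom_le])
    hence "degree ?Q < p" using False assms(3) by linarith
    thus ?thesis by blast
  qed auto
  have "(deriv ^^ p) (\<lambda>z. (z / w) ^ r / (z - w)) z = (deriv ^^ p) (\<lambda>z. 1 / (z - w) + poly ?Q z) z"
    by (rule higher_deriv_transform_within_open[where S = "- {w}"])
       (use assms power_over_linear_eq in \<open>auto intro!: holomorphic_intros\<close>)
  also have "\<dots> = (deriv ^^ p) (\<lambda>z. 1 / (z - w)) z + (deriv ^^ p) (poly ?Q) z"
    by (rule higher_deriv_add[where S = "- {w}"])
       (use assms in \<open>auto intro!: holomorphic_intros\<close>)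
  finally show ?thesis
    using higher_deriv_poly_eq_0[OF Q] higher_deriv_inverse_linear[OF assms(2)] by simp
qed

text \<open>
  The logarithmic derivative of $E_r(z/w)$ is
  $\frac{1}{z-w} + \frac1w \sum_{j<r} (z/w)^j$, and the geometric sum collapses it to a single
  fraction. In this form it is visibly $O(|w|^{-(r+1)})$ for large $w$, uniformly for $z$
  in a bounded set.
\<close>
lemma logderiv_weierstrass_factor:
  fixes z w :: complex
  assumes "w \<noteq> 0" "z \<noteq> w"
  shows "deriv (\<lambda>z. weierstrass_factor r (z / w)) z / weierstrass_factor r (z / w) = (z / w) ^ r / (z - w)"
proof -
  define e where "e = exp (\<Sum>k=1..r. (z / w) ^ k / of_nat k)"
  have "((\<lambda>z. (1 - z / w) * exp (\<Sum>k=1..r. (z / w) ^ k / of_nat k)) has_field_derivative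
      (- 1 / w) * e + (1 - z / w) * (e * (\<Sum>k=1..r. of_nat k * (z / w) ^ (k - 1) * (1 / w) / of_nat k))) (at z)"
    unfolding e_def by (rule derivative_eq_intros refl | use assms in simp)+
  also have "(\<Sum>k=1..r. of_nat k * (z / w) ^ (k - 1) * (1 / w) / of_nat k) = (\<Sum>k=1..r. (z / w) ^ (k - 1) * (1 / w))"
    by (intro sum.cong) auto
  also have "\<dots> = (1 / w) * (\<Sum>j<r. (z / w) ^ j)"
    unfolding sum_distrib_left
    by (rule sum.reindex_bij_witness[of _ Suc "\<lambda>k. k - 1"]) auto
  also have "(- 1 / w) * e + (1 - z / w) * (e * (1 / w * (\<Sum>j<r. (z / w) ^ j))) =
     - (e / w) * (1 + (z / w - 1) * (\<Sum>j<r. (z / w) ^ j))"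
    using assms(1) by (simp add: divide_simps) (simp add: algebra_simps)
  also have "1 + (z / w - 1) * (\<Sum>j<r. (z / w) ^ j) = (z / w) ^ r"
    unfolding power_diff_1_eq[symmetric] by simp
  finally have "deriv (\<lambda>z. weierstrass_factor r (z / w)) z = - (e / w) * (z / w) ^ r"
    unfolding weierstrass_factor_def by (rule DERIV_imp_deriv)
  moreover have "weierstrass_factor r (z / w) = - (e / w) * (z - w)"
    using assms by (simp add: weierstrass_factor_def e_def divide_simps) (simp add: algebra_simps)
  moreover have "- (e / w) \<noteq> 0" using assms by (simp add: e_def)
  ultimately show ?thesis
    by (simp only: mult_divide_mult_cancel_left_if if_False)
qed

section \<open>Matching two enumerations of a multiset\<close>

text \<open>Bijections between the two fibres over each value are glued together.\<close>
lemma exists_fibrewise_bij_betw: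
  assumes fin: "\<And>c. finite {i\<in>A. u i = c}" "\<And>c. finite {m\<in>B. v m = c}"
    and card: "\<And>c. card {i\<in>A. u i = c} = card {m\<in>B. v m = c}"
  shows "\<exists>h. bij_betw h A B \<and> (\<forall>i\<in>A. v (h i) = u i)"
proof -
  have "\<forall>c. \<exists>h. bij_betw h {i\<in>A. u i = c} {m\<in>B. v m = c}"
    using finite_same_card_bij[OF fin card] by blast
  then obtain H where H: "\<And>c. bij_betw (H c) {i\<in>A. u i = c} {m\<in>B. v m = c}"
    by metis
  define h where "h = (\<lambda>i. H (u i) i)"
  have h: "h i \<in> B \<and> v (h i) = u i" if "i \<in> A" for i
    using bij_betwE[OF H[of "u i"]] that by (auto simp: h_def)
  have "inj_on h A"
  proof (rule inj_onI)
    fix i j assume ij: "i \<in> A" "j \<in> A" "h i = h j"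
    hence "u i = u j" using h by metis
    thus "i = j"
      using inj_onD[OF bij_betw_imp_inj_on[OF H[of "u i"]], of i j] ij by (auto simp: h_def)
  qed
  moreover have "B \<subseteq> h ` A"
  proof
    fix m assume "m \<in> B"
    hence "m \<in> H (v m) ` {i\<in>A. u i = v m}"
      using bij_betw_imp_surj_on[OF H[of "v m"]] by auto
    then obtain i where "i \<in> A" "u i = v m" "m = H (v m) i" by blast
    hence "m = h i" by (simp add: h_def)
    thus "m \<in> h ` A" using \<open>i \<in> A\<close> by blast
  qed
  ultimately have "bij_betw h A B" using h by (auto simp: bij_betw_def)
  thus ?thesis using h by blast
qed

section \<open>The branch of the logarithm\<close>

text \<open>
  The choice in the definition is only meaningful once a branch that is real on the positive axis
  exists. Any holomorphic logarithm of $f$ on the slit plane differs on the positive axis from the real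
  logarithm by a continuous function with values in $2\pi i \mathbb{Z}$, that is, by a constant, which may be
  subtracted.
\<close>
lemma log_branch_properties:
  assumes holo: "f holomorphic_on UNIV"
    and zeros: "\<And>z. f z = 0 \<Longrightarrow> z \<in> \<real>\<^sub>\<le>\<^sub>0"
    and real: "\<And>x::real. f (of_real x) \<in> \<real>"
    and pos: "\<And>x::real. x > 0 \<Longrightarrow> Re (f (of_real x)) > 0"
  shows "log_branch f holomorphic_on - \<real>\<^sub>\<le>\<^sub>0"
    and "z \<notin> \<real>\<^sub>\<le>\<^sub>0 \<Longrightarrow> exp (log_branch f z) = f z"
proof -
  have slit: "- \<real>\<^sub>\<le>\<^sub>0 = - complex_of_real ` {..0}"
    by (auto simp: complex_slot_left_eq complex_nonpos_Reals_iff)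
  have op: "open (- \<real>\<^sub>\<le>\<^sub>0 :: complex set)"
    by (simp add: open_Compl)
  have sc: "simply_connected (- \<real>\<^sub>\<le>\<^sub>0 :: complex set)"
    unfolding slit by (intro starlike_imp_simply_connected starlike_slotted_complex_plane_left)
  obtain L where L: "L holomorphic_on - \<real>\<^sub>\<le>\<^sub>0" "\<And>z. z \<in> - \<real>\<^sub>\<le>\<^sub>0 \<Longrightarrow> f z = exp (L z)"
  proof -
    have "f holomorphic_on - \<real>\<^sub>\<le>\<^sub>0" using holo by (rule holomorphic_on_subset) simp
    moreover have "\<forall>z\<in>- \<real>\<^sub>\<le>\<^sub>0. f z \<noteq> 0" using zeros by auto
    ultimately show thesis using sc that unfolding simply_connected_eq_holomorphic_log[OF op] by blast
  qed
  define c where "c = (\<lambda>x::real. L (of_real x) - of_real (ln (Re (f (of_real x)))))"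
  have c_period: "\<exists>k::int. c x = (of_int (2 * k) * pi) * \<i>" if "x > 0" for x
  proof -
    have "exp (L (of_real x)) = f (of_real x)"
      using L(2)[of "of_real x"] that by simp
    also have "\<dots> = of_real (Re (f (of_real x)))"
      using real[of x] by simp
    also have "\<dots> = exp (of_real (ln (Re (f (of_real x)))))"
      using pos[OF that] by (simp add: exp_of_real)
    finally show ?thesis by (auto simp: exp_eq c_def)
  qed
  have "c constant_on {0<..}"
  proof (rule continuous_discrete_range_constant)
    have "continuous_on {0<..} (\<lambda>x::real. L (of_real x))"
      by (rule continuous_on_compose2[OF holomorphic_on_imp_continuous_on[OF L(1)]])
         (auto intro!: continuous_intros)
    moreover have "continuous_on {0<..} (\<lambda>x::real. f (of_real x))"
      by (rule continuous_on_compose2[OF holomorphic_on_imp_continuous_on[OF holo]])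
         (auto intro!: continuous_intros)
    hence "continuous_on {0<..} (\<lambda>x::real. ln (Re (f (of_real x))))"
      by (intro continuous_on_ln continuous_on_Re) (assumption, metis greaterThan_iff less_irrefl pos)
    ultimately show "continuous_on {0<..} c"
      unfolding c_def by (intro continuous_on_diff continuous_on_of_real)
    show "\<exists>e>0. \<forall>y. y \<in> {0<..} \<and> c y \<noteq> c x \<longrightarrow> e \<le> norm (c y - c x)" if x: "x \<in> {0<..}" for x
      \<comment> \<open>Distinct values are at least \<open>2 * pi\<close> apart.\<close>
    proof (intro exI[of _ 1] conjI allI impI)
      fix y assume y: "y \<in> {0<..} \<and> c y \<noteq> c x"
      obtain k where k: "c x = (of_int (2 * k) * pi) * \<i>" using c_period x by auto
      obtain l where l: "c y = (of_int (2 * l) * pi) * \<i>" using c_period y by auto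
      have "l \<noteq> k" using y k l by auto
      have "c y - c x = of_real (2 * pi * of_int (l - k)) * \<i>"
        by (simp add: k l algebra_simps)
      hence "norm (c y - c x) = 2 * pi * \<bar>of_int (l - k)\<bar>"
        by (simp only: norm_mult norm_of_real norm_ii abs_mult) simp
      moreover have "(1::real) \<le> \<bar>of_int (l - k)\<bar>" using \<open>l \<noteq> k\<close> by linarith
      moreover have "1 \<le> 2 * pi" using pi_ge_two by linarith
      ultimately show "1 \<le> norm (c y - c x)"
        using mult_mono[of 1 "2 * pi" 1 "\<bar>of_int (l - k)\<bar>"] by simp
    qed simp
  qed auto
  then obtain C where C: "\<And>x. x > 0 \<Longrightarrow> c x = C"
    by (auto simp: constant_on_def)
  \<comment> \<open>Subtracting the constant keeps a logarithm, as it is a period of the exponential.\<close>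
  have expC: "exp C = 1"
    using c_period[of 1] C[of 1] by (auto simp: exp_eq_1)
  have "\<exists>L. L holomorphic_on - \<real>\<^sub>\<le>\<^sub>0 \<and> (\<forall>z\<in>- \<real>\<^sub>\<le>\<^sub>0. exp (L z) = f z) \<and>
      (\<forall>x::real. x > 0 \<longrightarrow> L (of_real x) \<in> \<real>)"
  proof (intro exI[of _ "\<lambda>z. L z - C"] conjI ballI allI impI)
    show "(\<lambda>z. L z - C) holomorphic_on - \<real>\<^sub>\<le>\<^sub>0"
      by (intro holomorphic_intros L(1))
    show "exp (L z - C) = f z" if "z \<in> - \<real>\<^sub>\<le>\<^sub>0" for z
      using L(2)[OF that] expC by (simp add: exp_diff)
    show "L (of_real x) - C \<in> \<real>" if "x > 0" for x
      using C[OF that] by (auto simp: c_def)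
  qed
  from someI_ex[OF this]
  show "log_branch f holomorphic_on - \<real>\<^sub>\<le>\<^sub>0" "z \<notin> \<real>\<^sub>\<le>\<^sub>0 \<Longrightarrow> exp (log_branch f z) = f z"
    by (auto simp: log_branch_def)
qed

section \<open>Canonical products over a subset of the natural numbers\<close>

text \<open>
  The index set is kept as an arbitrary set of natural numbers, finite or infinite: this covers
  functions with finitely many zeros, and it allows a factor to be removed from the product without
  renumbering.
\<close>
locale weierstrass_family =
  fixes r :: nat and J :: "nat set" and w :: "nat \<Rightarrow> complex"
  assumes w_nz: "i \<in> J \<Longrightarrow> w i \<noteq> 0"
    and summable_w: "(\<lambda>i. 1 / norm (w i) ^ (r + 1)) summable_on J"
begin

definition factor :: "nat \<Rightarrow> complex \<Rightarrow> complex" where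
  "factor i z = (if i \<in> J then weierstrass_factor r (z / w i) else 1)"

definition canonical_product :: "complex \<Rightarrow> complex" where
  "canonical_product z = (\<Prod>i. factor i z)"

definition majorant :: "nat \<Rightarrow> real" where
  "majorant i = (if i \<in> J then 1 / norm (w i) ^ (r + 1) else 0)"

definition logderiv_term :: "nat \<Rightarrow> complex \<Rightarrow> complex" where
  "logderiv_term i z = (if i \<in> J then (z / w i) ^ r / (z - w i) else 0)"

lemma summable_majorant: "summable majorant"
  unfolding majorant_def using has_sum_imp_sums_restrict[OF has_sum_infsum[OF summable_w]]
  by (simp add: sums_iff)

lemma eventually_large: "eventually (\<lambda>i. i \<in> J \<longrightarrow> norm (w i) > R) sequentially"
proof -
  define R' where "R' = max R 1"
  have R': "R' > 0" "R \<le> R'" by (auto simp: R'_def)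
  have "majorant \<longlonglongrightarrow> 0" by (rule summable_LIMSEQ_zero[OF summable_majorant])
  hence "eventually (\<lambda>i. majorant i < 1 / R' ^ (r + 1)) sequentially"
    using R' by (intro order_tendstoD) auto
  thus ?thesis
  proof eventually_elim
    case (elim i)
    show ?case
    proof
      assume i: "i \<in> J"
      have "norm (w i) > 0" using w_nz[OF i] by simp
      hence "R' ^ (r + 1) < norm (w i) ^ (r + 1)"
        using elim i R' by (simp add: majorant_def divide_simps del: power_Suc)
      hence "R' < norm (w i)"
        by (rule power_less_imp_less_base) simp
      thus "norm (w i) > R" using R' by simp
    qed
  qed
qed

lemma finite_fibre: "finite {i\<in>J. w i = c}"
proof -
  obtain N where "\<And>i. i \<ge> N \<Longrightarrow> i \<in> J \<Longrightarrow> norm (w i) > norm c"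
    using eventually_large[of "norm c"] by (auto simp: eventually_at_top_linorder)
  hence "{i\<in>J. w i = c} \<subseteq> {..<N}"
    by (force simp: not_le[symmetric])
  thus ?thesis by (rule finite_subset) simp
qed

lemma holomorphic_factor [holomorphic_intros]: "factor i holomorphic_on A"
  unfolding factor_def by (cases "i \<in> J") (auto intro!: holomorphic_intros w_nz)

lemma eventually_factor_bound:
  assumes "R > 0"
  shows "eventually (\<lambda>i. \<forall>z\<in>cball 0 R. norm (norm (factor i z - 1)) \<le> 3 * R ^ (r + 1) * majorant i) sequentially"
  using eventually_large[of "2 * R"]
proof eventually_elim
  case (elim i)
  show ?case
  proof
    fix z :: complex assume z: "z \<in> cball 0 R"
    show "norm (norm (factor i z - 1)) \<le> 3 * R ^ (r + 1) * majorant i"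
    proof (cases "i \<in> J")
      case True
      have "norm (z / w i) \<le> 1 / 2"
        using elim True z assms w_nz[OF True] by (auto simp: norm_divide divide_simps)
      hence "norm (factor i z - 1) \<le> 3 * norm (z / w i) ^ Suc r"
        using weierstrass_factor_bound True by (simp add: factor_def del: power_Suc)
      also have "\<dots> \<le> 3 * (R / norm (w i)) ^ Suc r"
        unfolding norm_divide
        by (intro mult_left_mono power_mono divide_right_mono) (use z in auto)
      also have "\<dots> = 3 * R ^ (r + 1) * majorant i"
        using True by (simp add: majorant_def power_divide)
      finally show ?thesis by simp
    qed (use assms in \<open>simp add: factor_def majorant_def\<close>)
  qed
qed

lemma has_prod_canonical_product: "(\<lambda>i. factor i z) has_prod canonical_product z"
proof -
  have "summable (\<lambda>i. norm (factor i z - 1))"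
  proof (rule summable_comparison_test_ev)
    show "eventually (\<lambda>i. norm (norm (factor i z - 1)) \<le> 3 * (norm z + 1) ^ (r + 1) * majorant i) sequentially"
    proof (rule eventually_mono[OF eventually_factor_bound])
      show "norm z + 1 > 0" by (intro add_nonneg_pos) auto
    qed simp
    show "summable (\<lambda>i. 3 * (norm z + 1) ^ (r + 1) * majorant i)"
      by (intro summable_mult summable_majorant)
  qed
  hence "convergent_prod (\<lambda>i. factor i z)"
    by (intro abs_convergent_prod_imp_convergent_prod) (simp add: abs_convergent_prod_conv_summable)
  thus ?thesis unfolding canonical_product_def by (rule convergent_prod_has_prod)
qed

lemma canonical_product_eq_0_iff: "canonical_product z = 0 \<longleftrightarrow> (\<exists>i\<in>J. w i = z)"
proof -
  have "canonical_product z = 0 \<longleftrightarrow> (\<exists>i. 0 = factor i z)"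
    unfolding has_prod_eq_0_iff[OF has_prod_canonical_product] image_iff by simp
  moreover have "0 = factor i z \<longleftrightarrow> i \<in> J \<and> w i = z" for i
    using w_nz[of i] by (auto simp: factor_def)
  ultimately show ?thesis by blast
qed

lemma uniform_limit_canonical_product:
  assumes "R > 0"
  shows "uniform_limit (cball 0 R) (\<lambda>N z. \<Prod>i<N. factor i z) canonical_product sequentially"
proof -
  have "uniformly_convergent_on (cball 0 R) (\<lambda>N z. \<Prod>i<N. factor i z)"
  proof (rule uniformly_convergent_on_prod')
    show "uniformly_convergent_on (cball 0 R) (\<lambda>N z. \<Sum>i<N. norm (factor i z - 1))"
      by (rule Weierstrass_m_test'_ev[OF eventually_factor_bound[OF assms]])
         (intro summable_mult summable_majorant)
  qed (auto intro!: holomorphic_on_imp_continuous_on holomorphic_intros)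
  then obtain g where g: "uniform_limit (cball 0 R) (\<lambda>N z. \<Prod>i<N. factor i z) g sequentially"
    by (auto simp: uniformly_convergent_on_def)
  also have "?this \<longleftrightarrow> uniform_limit (cball 0 R) (\<lambda>N z. \<Prod>i<N. factor i z) canonical_product sequentially"
  proof (intro uniform_limit_cong)
    fix z :: complex assume "z \<in> cball 0 R"
    from LIMSEQ_Suc[OF tendsto_uniform_limitI[OF g this]]
    have "(\<lambda>N. \<Prod>i<Suc N. factor i z) \<longlonglongrightarrow> g z" .
    moreover have "(\<lambda>N. \<Prod>i<Suc N. factor i z) \<longlonglongrightarrow> canonical_product z"
      using convergent_prod_LIMSEQ[OF has_prod_iff[THEN iffD1, OF has_prod_canonical_product[of z], THEN conjunct1]]
      unfolding lessThan_Suc_atMost by (simp add: canonical_product_def)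
    ultimately show "g z = canonical_product z" by (rule LIMSEQ_unique)
  qed auto
  finally show ?thesis .
qed

lemma holomorphic_canonical_product: "canonical_product holomorphic_on A"
proof (rule holomorphic_on_subset)
  show "canonical_product holomorphic_on UNIV"
  proof (rule holomorphic_uniform_sequence)
    fix z :: complex
    have "uniform_limit (cball 0 (norm z + 1)) (\<lambda>N z. \<Prod>i<N. factor i z) canonical_product sequentially"
      by (rule uniform_limit_canonical_product) (auto intro: add_nonneg_pos)
    hence "uniform_limit (cball z 1) (\<lambda>N z. \<Prod>i<N. factor i z) canonical_product sequentially"
      by (rule uniform_limit_on_subset) (simp add: cball_subset_cball_iff)
    thus "\<exists>d>0. cball z d \<subseteq> UNIV \<and> uniform_limit (cball z d) (\<lambda>N z. \<Prod>i<N. factor i z) canonical_product sequentially"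
      by (intro exI[of _ 1]) auto
  qed (auto intro!: holomorphic_intros)
qed auto

lemma logderiv_canonical_product_sums:
  assumes "z \<notin> w ` J"
  shows "(\<lambda>i. logderiv_term i z) sums (deriv canonical_product z / canonical_product z)"
proof -
  have "(\<lambda>i. deriv (factor i) z / factor i z) sums (deriv canonical_product z / canonical_product z)"
  proof (rule logderiv_prodinf_complex_uniform_limit)
    show "uniform_limit (ball 0 (norm z + 1)) (\<lambda>N z. \<Prod>i<N. factor i z) canonical_product sequentially"
      by (rule uniform_limit_on_subset[OF uniform_limit_canonical_product[of "norm z + 1"]]) (auto intro: add_nonneg_pos)
    show "canonical_product z \<noteq> 0" using assms by (auto simp: canonical_product_eq_0_iff)
  qed (auto intro!: holomorphic_intros)
  also have "(\<lambda>i. deriv (factor i) z / factor i z) = (\<lambda>i. logderiv_term i z)"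
  proof
    fix i
    show "deriv (factor i) z / factor i z = logderiv_term i z"
    proof (cases "i \<in> J")
      case True
      thus ?thesis using logderiv_weierstrass_factor[OF w_nz[OF True], of z r] assms
        by (auto simp: factor_def[abs_def] logderiv_term_def)
    next
      case False
      thus ?thesis by (simp add: factor_def[abs_def] logderiv_term_def)
    qed
  qed
  finally show ?thesis .
qed

lemma uniform_limit_logderiv:
  assumes "R > 0"
  shows "uniform_limit (cball 0 R) (\<lambda>N z. \<Sum>i<N. logderiv_term i z) (\<lambda>z. \<Sum>i. logderiv_term i z) sequentially"
proof (rule Weierstrass_m_test_ev)
  show "eventually (\<lambda>i. \<forall>z\<in>cball 0 R. norm (logderiv_term i z) \<le> 2 * R ^ r * majorant i) sequentially"
    using eventually_large[of "2 * R"]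
  proof eventually_elim
    case (elim i)
    show ?case
    proof
      fix z :: complex assume z: "z \<in> cball 0 R"
      show "norm (logderiv_term i z) \<le> 2 * R ^ r * majorant i"
      proof (cases "i \<in> J")
        case True
        have "norm (w i) / 2 \<le> norm (w i) - norm z"
          using elim True z by auto
        also have "\<dots> \<le> norm (z - w i)"
          by (metis norm_minus_commute norm_triangle_ineq2)
        finally have ge: "norm (w i) / 2 \<le> norm (z - w i)" .
        have pos: "norm (w i) > 0" using w_nz[OF True] by simp
        have "norm (logderiv_term i z) = (norm z / norm (w i)) ^ r / norm (z - w i)"
          using True by (simp add: logderiv_term_def norm_divide norm_power)
        also have "\<dots> \<le> (R / norm (w i)) ^ r / (norm (w i) / 2)"
          using z pos ge assms by (intro frac_le power_mono divide_right_mono) auto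
        also have "\<dots> = 2 * R ^ r * majorant i"
          using True pos by (simp add: majorant_def power_divide mult_ac)
        finally show ?thesis .
      qed (use assms in \<open>simp add: logderiv_term_def majorant_def\<close>)
    qed
  qed
  show "summable (\<lambda>i. 2 * R ^ r * majorant i)"
    by (intro summable_mult summable_majorant)
qed

text \<open>This isolates the factors that vanish at a given point.\<close>
lemma canonical_product_split:
  assumes "K \<subseteq> J" "finite K"
  shows "canonical_product z = (\<Prod>i\<in>K. weierstrass_factor r (z / w i)) * weierstrass_family.canonical_product r (J - K) w z"
proof -
  interpret rest: weierstrass_family r "J - K" w
    by standard (use w_nz summable_on_subset[OF summable_w] in auto)
  have "(\<lambda>i. (if i \<in> K then weierstrass_factor r (z / w i) else 1) * rest.factor i z) has_prod
     ((\<Prod>i\<in>K. weierstrass_factor r (z / w i)) * rest.canonical_product z)"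
    by (intro has_prod_mult has_prod_If_finite_set rest.has_prod_canonical_product assms)
  also have "(\<lambda>i. (if i \<in> K then weierstrass_factor r (z / w i) else 1) * rest.factor i z) = (\<lambda>i. factor i z)"
    using assms by (auto simp: factor_def rest.factor_def fun_eq_iff)
  finally show ?thesis
    using has_prod_canonical_product has_prod_unique2 by blast
qed

text \<open>
  The factors vanishing at $c$ are finitely many, and each is $(z-c)$ times the same zero-free function
  \<open>e\<close>. Separating them leaves a canonical product that does not vanish at $c$.
\<close>
lemma zorder_eq_count:
  assumes f: "\<And>z. f z = z ^ d * exp (poly q z) * canonical_product z"
  shows "zorder f c = int ((if c = 0 then d else 0) + card {i\<in>J. w i = c})"
proof -
  define K where "K = {i\<in>J. w i = c}"
  have K: "K \<subseteq> J" "finite K" using finite_fibre by (auto simp: K_def)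
  interpret rest: weierstrass_family r "J - K" w
    by standard (use w_nz summable_on_subset[OF summable_w] in auto)
  define e where "e = (\<lambda>z. - (1 / c) * exp (\<Sum>k=1..r. (z / c) ^ k / of_nat k))"
  \<comment> \<open>The cofactor of \<open>(z - c) ^ N\<close>; at the origin it is \<open>z ^ d\<close> that vanishes, and \<open>K\<close> is empty.\<close>
  define G where "G = (\<lambda>z. (if c = 0 then 1 else z ^ d) * exp (poly q z) * e z ^ card K * rest.canonical_product z)"
  have c_nz: "c \<noteq> 0" if "K \<noteq> {}" using that w_nz by (auto simp: K_def)
  show ?thesis
  proof (rule zorder_eqI[of UNIV c G])
    show "G holomorphic_on UNIV"
    proof (cases "c = 0")
      case True
      hence "K = {}" using c_nz by auto
      thus ?thesis using True
        unfolding G_def by (auto intro!: holomorphic_intros holomorphic_canonical_product)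
    next
      case False
      thus ?thesis
        unfolding G_def e_def by (auto intro!: holomorphic_intros rest.holomorphic_canonical_product)
    qed
    have "rest.canonical_product c \<noteq> 0" unfolding rest.canonical_product_eq_0_iff by (auto simp: K_def)
    moreover have "e c ^ card K \<noteq> 0"
      using c_nz by (cases "K = {}") (auto simp: e_def)
    ultimately show "G c \<noteq> 0" by (auto simp: G_def)
    fix z assume "z \<noteq> c"
    have "(\<Prod>i\<in>K. weierstrass_factor r (z / w i)) = (\<Prod>i\<in>K. (z - c) * e z)"
    proof (intro prod.cong refl)
      fix i assume "i \<in> K"
      hence "w i = c" "c \<noteq> 0" using c_nz by (auto simp: K_def)
      thus "weierstrass_factor r (z / w i) = (z - c) * e z"
        by (simp add: weierstrass_factor_def e_def field_simps)
    qed
    hence "canonical_product z = (z - c) ^ card K * e z ^ card K * rest.canonical_product z"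
      using canonical_product_split[OF K, of z] by (simp add: power_mult_distrib)
    hence "f z = G z * (z - c) ^ ((if c = 0 then d else 0) + card K)"
      unfolding f by (simp add: G_def power_add)
    thus "f z = G z * (z - c) powi int ((if c = 0 then d else 0) + card {i\<in>J. w i = c})"
      by (simp only: power_int_of_nat K_def)
  qed auto
qed

text \<open>
  The logarithmic derivative of $f$ is a locally uniform limit of rational functions plus the
  polynomial $q'$, so it may be differentiated $p$ times term by term. This removes $q'$ and the
  polynomial part of every term, and leaves the poles.
\<close>
lemma tendsto_higher_deriv_log:
  assumes f: "\<And>z. f z = z ^ d * exp (poly q z) * canonical_product z"
    and L: "L holomorphic_on S" "\<And>z. z \<in> S \<Longrightarrow> exp (L z) = f z"
    and S: "open S" "z \<in> S"
    and p: "p \<ge> 1" "degree q \<le> p" "r \<le> p"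
  shows "(\<lambda>N. (-1) ^ p * fact p * (of_nat d / z ^ (p + 1) +
            (\<Sum>i<N. if i \<in> J then 1 / (z - w i) ^ (p + 1) else 0)))
          \<longlonglongrightarrow> (deriv ^^ (p + 1)) L z"
proof -
  define g where "g = (\<lambda>z. of_nat d * (1 / (z - 0)) + poly (pderiv q) z + (\<Sum>i. logderiv_term i z))"
  define A where "A = (\<lambda>N z. of_nat d * (1 / (z - 0)) + poly (pderiv q) z + (\<Sum>i<N. logderiv_term i z))"
  have nz: "f z \<noteq> 0" if "z \<in> S" for z using L(2)[OF that] by (metis exp_not_eq_zero)
  have avoid: "z \<noteq> w i" if "z \<in> S" "i \<in> J" for z i
    using nz[OF that(1)] that(2) by (auto simp: f canonical_product_eq_0_iff)
  have avoid0: "z \<noteq> 0 \<or> d = 0" if "z \<in> S" for z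
    using nz[OF that] by (auto simp: f)
  have dL: "deriv L z = g z" if z: "z \<in> S" for z
  proof -
    have "((\<lambda>z. exp (L z)) has_field_derivative exp (L z) * deriv L z) (at z)"
      by (intro DERIV_fun_exp holomorphic_derivI[OF L(1) S(1) z])
    from has_field_derivative_transform_within_open[OF this S(1) z L(2)]
    have 1: "(f has_field_derivative f z * deriv L z) (at z)"
      by (simp add: L(2)[OF z])
    have "(canonical_product has_field_derivative deriv canonical_product z) (at z)"
      by (rule holomorphic_derivI[OF holomorphic_canonical_product[of UNIV]]) auto
    from DERIV_mult[OF DERIV_mult[OF DERIV_power[OF DERIV_ident, of d]
          DERIV_fun_exp[OF poly_DERIV[of q z]]] this]
    have "((\<lambda>z. z ^ d * exp (poly q z) * canonical_product z) has_field_derivative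
        (of_nat d * z ^ (d - 1)) * exp (poly q z) * canonical_product z +
        z ^ d * (exp (poly q z) * poly (pderiv q) z) * canonical_product z + z ^ d * exp (poly q z) * deriv canonical_product z) (at z)"
      by (simp add: algebra_simps)
    hence "(f has_field_derivative (of_nat d * z ^ (d - 1)) * exp (poly q z) * canonical_product z +
        z ^ d * (exp (poly q z) * poly (pderiv q) z) * canonical_product z + z ^ d * exp (poly q z) * deriv canonical_product z) (at z)"
      by (simp only: f[abs_def])
    with 1 have "f z * deriv L z = (of_nat d * z ^ (d - 1)) * exp (poly q z) * canonical_product z +
        z ^ d * (exp (poly q z) * poly (pderiv q) z) * canonical_product z + z ^ d * exp (poly q z) * deriv canonical_product z"
      by (rule DERIV_unique)
    also have "of_nat d * z ^ (d - 1) = of_nat d * (1 / (z - 0)) * z ^ d"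
      using avoid0[OF z] by (cases d) auto
    also have "of_nat d * (1 / (z - 0)) * z ^ d * exp (poly q z) * canonical_product z +
        z ^ d * (exp (poly q z) * poly (pderiv q) z) * canonical_product z + z ^ d * exp (poly q z) * deriv canonical_product z =
        f z * (of_nat d * (1 / (z - 0)) + poly (pderiv q) z + deriv canonical_product z / canonical_product z)"
      using nz[OF z] unfolding f by (simp add: algebra_simps)
    also have "deriv canonical_product z / canonical_product z = (\<Sum>i. logderiv_term i z)"
      using logderiv_canonical_product_sums[of z] avoid[OF z] by (force simp: sums_iff)
    finally show ?thesis using nz[OF z] by (simp add: g_def)
  qed
  have "(deriv ^^ (p + 1)) L z = (deriv ^^ p) (deriv L) z"
    by (simp add: funpow_swap1)
  also have "\<dots> = (deriv ^^ p) g z"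
  proof (rule higher_deriv_transform_within_open[OF _ _ S dL])
    show dL_holo: "deriv L holomorphic_on S" by (intro holomorphic_deriv L S)
    show "g holomorphic_on S"
      using holomorphic_transform[OF dL_holo dL] .
  qed
  finally have eq: "(deriv ^^ (p + 1)) L z = (deriv ^^ p) g z" .

  obtain \<delta> where \<delta>: "\<delta> > 0" "ball z \<delta> \<subseteq> S"
    using S open_contains_ball by blast
  have holo_inv: "(\<lambda>z. of_nat d * (1 / (z - 0))) holomorphic_on S"
    by (cases "d = 0") (use avoid0 in \<open>auto intro!: holomorphic_intros\<close>)
  have holo_term: "logderiv_term i holomorphic_on S" for i
    unfolding logderiv_term_def[abs_def] by (cases "i \<in> J") (use w_nz avoid in \<open>auto intro!: holomorphic_intros\<close>)
  have "uniform_limit (ball z \<delta>) A g sequentially"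
    unfolding A_def g_def
  proof (intro uniform_limit_add uniform_limit_const)
    have "norm z + \<delta> > 0" using \<delta> by (auto intro: add_nonneg_pos)
    from uniform_limit_logderiv[OF this]
    show "uniform_limit (ball z \<delta>) (\<lambda>N z. \<Sum>i<N. logderiv_term i z) (\<lambda>z. \<Sum>i. logderiv_term i z) sequentially"
    proof (rule uniform_limit_on_subset)
      show "ball z \<delta> \<subseteq> cball 0 (norm z + \<delta>)"
      proof
        fix x assume "x \<in> ball z \<delta>"
        thus "x \<in> cball 0 (norm z + \<delta>)"
          using norm_triangle_sub[of x z] by (simp add: dist_norm norm_minus_commute)
      qed
    qed
  qed
  moreover have "A N holomorphic_on ball z \<delta>" for N
    unfolding A_def
    by (intro holomorphic_on_add holomorphic_on_sum holomorphic_on_subset[OF holo_inv \<delta>(2)]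
          holomorphic_on_subset[OF holo_term \<delta>(2)] holomorphic_intros)
  ultimately have "(\<lambda>N. (deriv ^^ p) (A N) z) \<longlonglongrightarrow> (deriv ^^ p) g z"
    by (intro higher_deriv_complex_uniform_limit[where A = "ball z \<delta>"]) (use \<delta> in auto)
  also have "(\<lambda>N. (deriv ^^ p) (A N) z) = (\<lambda>N. (-1) ^ p * fact p * (of_nat d / z ^ (p + 1) +
            (\<Sum>i<N. if i \<in> J then 1 / (z - w i) ^ (p + 1) else 0)))"
  proof
    fix N
    have "(deriv ^^ p) (A N) z = (deriv ^^ p) (\<lambda>z. of_nat d * (1 / (z - 0)) + poly (pderiv q) z) z
            + (deriv ^^ p) (\<lambda>z. \<Sum>i<N. logderiv_term i z) z"
      unfolding A_def
      by (rule higher_deriv_add[where S = S]) (use holo_inv holo_term S in \<open>auto intro!: holomorphic_intros\<close>)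
    also have "(deriv ^^ p) (\<lambda>z. of_nat d * (1 / (z - 0)) + poly (pderiv q) z) z =
        (deriv ^^ p) (\<lambda>z. of_nat d * (1 / (z - 0))) z + (deriv ^^ p) (poly (pderiv q)) z"
      by (rule higher_deriv_add[where S = S]) (use holo_inv S in \<open>auto intro!: holomorphic_intros\<close>)
    also have "(deriv ^^ p) (poly (pderiv q)) z = 0"
      using p by (intro higher_deriv_poly_eq_0) (auto simp: pderiv_eq_0_iff degree_pderiv)
    also have "(deriv ^^ p) (\<lambda>z. of_nat d * (1 / (z - 0))) z = of_nat d * ((-1) ^ p * fact p / z ^ (p + 1))"
    proof (cases "d = 0")
      case False
      hence "z \<noteq> 0" using avoid0[OF S(2)] by simp
      have "(deriv ^^ p) (\<lambda>z. of_nat d * (1 / (z - 0))) z = of_nat d * (deriv ^^ p) (\<lambda>z. 1 / (z - 0)) z"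
        by (rule higher_deriv_cmult[where A = "- {0}"]) (use \<open>z \<noteq> 0\<close> in \<open>auto intro!: holomorphic_intros\<close>)
      thus ?thesis using higher_deriv_inverse_linear[OF \<open>z \<noteq> 0\<close>, of p] by simp
    qed simp
    also have "(deriv ^^ p) (\<lambda>z. \<Sum>i<N. logderiv_term i z) z = (\<Sum>i<N. (deriv ^^ p) (logderiv_term i) z)"
      by (rule higher_deriv_sum[where S = S]) (use holo_term S in auto)
    also have "\<dots> = (\<Sum>i<N. if i \<in> J then (-1) ^ p * fact p / (z - w i) ^ (p + 1) else 0)"
    proof (intro sum.cong refl)
      fix i
      show "(deriv ^^ p) (logderiv_term i) z = (if i \<in> J then (-1) ^ p * fact p / (z - w i) ^ (p + 1) else 0)"
      proof (cases "i \<in> J")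
        case True
        from higher_deriv_power_over_linear[OF w_nz[OF True] avoid[OF S(2) True] p(3)]
        show ?thesis using True by (simp add: logderiv_term_def[abs_def])
      qed (simp add: logderiv_term_def[abs_def])
    qed
    also have "\<dots> = (-1) ^ p * fact p * (\<Sum>i<N. if i \<in> J then 1 / (z - w i) ^ (p + 1) else 0)"
      unfolding sum_distrib_left by (intro sum.cong) auto
    finally show "(deriv ^^ p) (A N) z = (-1) ^ p * fact p * (of_nat d / z ^ (p + 1) +
            (\<Sum>i<N. if i \<in> J then 1 / (z - w i) ^ (p + 1) else 0))"
      by (simp add: algebra_simps)
  qed
  finally show ?thesis by (simp only: eq)
qed

end

section \<open>Summation over the zeros\<close>

lemma (in balanced_shifts) abs_rho_le: "\<bar>rho n a b t\<bar> \<le> (\<Sum>k=1..n. \<bar>a k - b k\<bar>)"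
  unfolding rho_eq_sum_max by (rule sum_abs[THEN order_trans], rule sum_mono) auto

text \<open>
  With $k = p+1$ this is $e^{ys} = (e^{ys/k})^k \ge (1 + ys/k)^k$, written so that summability of
  $(x + \lambda_m)^{-(p+1)}$ for $x = k/s$ gives convergence of $h(s)$.
\<close>
lemma exp_minus_le_inverse_power:
  fixes s y :: real
  assumes "s > 0" "y \<ge> 0"
  shows "exp (- y * s) \<le> (of_nat (p + 1) / s) ^ (p + 1) * (1 / (of_nat (p + 1) / s + y) ^ (p + 1))"
proof -
  define k where "k = real (p + 1)"
  have k: "k > 0" by (simp add: k_def)
  have "(1 + y * s / k) ^ (p + 1) \<le> exp (y * s / k) ^ (p + 1)"
    using assms k exp_ge_add_one_self[of "y * s / k"] by (intro power_mono) auto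
  also have "\<dots> = exp (y * s)"
    using k by (simp add: exp_of_nat_mult[symmetric] k_def del: power_Suc)
  finally have le: "(1 + y * s / k) ^ (p + 1) \<le> exp (y * s)" .
  have "0 < 1 + y * s / k" using assms k by (intro add_pos_nonneg) auto
  hence "1 / exp (y * s) \<le> 1 / (1 + y * s / k) ^ (p + 1)"
    by (intro divide_left_mono le mult_pos_pos zero_less_power) auto
  hence "exp (- y * s) \<le> 1 / (1 + y * s / k) ^ (p + 1)"
    by (simp add: exp_minus divide_inverse)
  also have "1 + y * s / k = (k / s + y) / (k / s)"
    using assms k by (simp add: field_simps)
  finally show ?thesis by (simp add: power_divide power_mult_distrib mult_ac k_def del: power_Suc of_nat_add)
qed

text \<open>
  Of the zeros only their location and the convergence of $\sum_m (x + \lambda_m)^{-(p+1)}$ enter the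
  integral representations.
\<close>
locale shifts_and_zeros = balanced_shifts n a b
  for n :: nat and a b :: "nat \<Rightarrow> real" +
  fixes p :: nat and I :: "nat set" and lam :: "nat \<Rightarrow> real"
  assumes lam_nonneg: "m \<in> I \<Longrightarrow> 0 \<le> lam m"
    and summable_lam: "x > 0 \<Longrightarrow> (\<lambda>m. 1 / (x + lam m) ^ (p + 1)) summable_on I"
begin

lemma summable_exp_lam:
  assumes "s > 0"
  shows "(\<lambda>m. exp (- lam m * s)) summable_on I"
proof (rule summable_on_comparison_test)
  show "(\<lambda>m. (of_nat (p + 1) / s) ^ (p + 1) * (1 / (of_nat (p + 1) / s + lam m) ^ (p + 1))) summable_on I"
    using assms by (intro summable_on_cmult_right summable_lam) simp
  show "exp (- lam m * s) \<le> (of_nat (p + 1) / s) ^ (p + 1) * (1 / (of_nat (p + 1) / s + lam m) ^ (p + 1))"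
    if "m \<in> I" for m
    by (rule exp_minus_le_inverse_power[OF assms lam_nonneg[OF that]])
qed simp

text \<open>
  Only the $\lambda_m \le t$ contribute. For these $(1+|t|)/(1+\lambda_m) \ge 1$, which turns the
  bound on $\rho$ into a summable one.
\<close>
lemma abs_summable_rho_lam: "(\<lambda>m. \<bar>rho n a b (t - lam m)\<bar>) summable_on I"
proof (rule summable_on_comparison_test)
  define B where "B = (\<Sum>k=1..n. \<bar>a k - b k\<bar>)"
  have B: "B \<ge> 0" by (auto simp: B_def intro!: sum_nonneg)
  show "(\<lambda>m. (B * (1 + \<bar>t\<bar>) ^ (p + 1)) * (1 / (1 + lam m) ^ (p + 1))) summable_on I"
    by (intro summable_on_cmult_right summable_lam) simp
  fix m assume m: "m \<in> I"
  show "\<bar>rho n a b (t - lam m)\<bar> \<le> (B * (1 + \<bar>t\<bar>) ^ (p + 1)) * (1 / (1 + lam m) ^ (p + 1))"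
  proof (cases "lam m \<le> t")
    case True
    have "1 \<le> (1 + \<bar>t\<bar>) ^ (p + 1) / (1 + lam m) ^ (p + 1)"
      using True lam_nonneg[OF m] by (simp add: power_mono del: power_Suc)
    from mult_mono[OF abs_rho_le[of "t - lam m"] this] B show ?thesis
      by (simp add: B_def)
  next
    case False
    thus ?thesis using B lam_nonneg[OF m] by (simp add: rho_eq_0)
  qed
qed simp

lemma summable_rho_lam: "(\<lambda>m. rho n a b (t - lam m)) summable_on I"
  using abs_summable_rho_lam by (rule summable_on_iff_abs_summable_on_real[THEN iffD2, unfolded real_norm_def])

lemma has_sum_phi: "((\<lambda>m. rho n a b (t - lam m)) has_sum phi I lam n a b t) I"
  unfolding phi_def using summable_rho_lam by (rule has_sum_infsum)

lemma phi_eq_0: "t \<le> 0 \<Longrightarrow> phi I lam n a b t = 0"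
  unfolding phi_def by (rule infsum_0) (use lam_nonneg in \<open>force intro: rho_eq_0\<close>)

text \<open>
  The contribution of a single zero, up to the factor $p!$; the three expressions in the theorem are
  all shown to equal the sum of these.
\<close>
definition kernel_integral :: "complex \<Rightarrow> nat \<Rightarrow> complex" where
  "kernel_integral z m =
     (\<integral>u. of_real (rho n a b u) * (1 / (z + of_real (lam m) + of_real u) ^ (p + 1)) \<partial>lborel)"

context
  fixes z :: complex
  assumes z: "Re z > 0"
begin

lemma norm_kernel_le:
  assumes "m \<in> I" "u \<ge> 0"
  shows "norm (1 / (z + of_real (lam m) + of_real u) ^ (p + 1)) \<le> 1 / (Re z + lam m) ^ (p + 1)"
proof -
  have "Re z + lam m \<le> Re (z + of_real (lam m) + of_real u)"
    using assms by simp
  also have "\<dots> \<le> norm (z + of_real (lam m) + of_real u)"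
    by (rule complex_Re_le_cmod)
  finally have le: "Re z + lam m \<le> norm (z + of_real (lam m) + of_real u)" .
  have "0 < Re z + lam m" using z lam_nonneg[OF assms(1)] by simp
  thus ?thesis unfolding norm_divide norm_power norm_one
    by (intro divide_left_mono power_mono le mult_pos_pos zero_less_power) (use le in auto)
qed

lemma kernel_integrable:
  assumes "m \<in> I"
  shows "integrable lborel (\<lambda>u. of_real (rho n a b u) * (1 / (z + of_real (lam m) + of_real u) ^ (p + 1)))"
    and "(\<integral>u. norm (of_real (rho n a b u) * (1 / (z + of_real (lam m) + of_real u) ^ (p + 1))) \<partial>lborel)
          \<le> 1 / (Re z + lam m) ^ (p + 1) * rho_mass"
  by (rule integrable_rho_mult[OF _ norm_kernel_le[OF assms]]; measurable)+

lemma summable_kernel_bound: "(\<lambda>m. 1 / (Re z + lam m) ^ (p + 1) * C) summable_on I"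
  by (intro summable_on_cmult_left summable_lam z)

text \<open>
  After the substitution $t = u + \lambda_m$ the denominators no longer depend on $m$, and the
  numerators add up to $\phi(t)$.
\<close>
lemma stieltjes_phi:
  shows "set_integrable lborel {0<..} (\<lambda>t. of_real (phi I lam n a b t) / (z + of_real t) ^ (p + 1))"
    and "(LINT t:{0<..}|lborel. of_real (phi I lam n a b t) / (z + of_real t) ^ (p + 1)) =
          (\<Sum>\<^sub>\<infinity>m\<in>I. kernel_integral z m)"
proof -
  define k where "k = (\<lambda>m t. of_real (rho n a b (t - lam m)) * (1 / (z + of_real t) ^ (p + 1)))"
  define K where "K = (\<lambda>m u. of_real (rho n a b u) * (1 / (z + of_real (lam m) + of_real u) ^ (p + 1)))"
  have k_eq: "k m t = K m (- lam m + 1 * t)" for m t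
    by (simp add: k_def K_def)
  have int: "integrable lborel (k m)" if "m \<in> I" for m
    unfolding k_eq[abs_def] by (rule lborel_integrable_real_affine) (use kernel_integrable(1)[OF that] in \<open>auto simp: K_def\<close>)
  have val: "(\<integral>t. k m t \<partial>lborel) = kernel_integral z m" for m
    using lborel_integral_real_affine[of 1 "K m" "- lam m"] by (simp add: k_eq kernel_integral_def K_def)
  have norm_val: "(\<integral>t. norm (k m t) \<partial>lborel) = (\<integral>u. norm (K m u) \<partial>lborel)" for m
    using lborel_integral_real_affine[of 1 "\<lambda>u. norm (K m u)" "- lam m"] by (simp add: k_eq)
  have ptw: "(\<lambda>m. norm (k m t)) summable_on I" for t
  proof -
    have "(\<lambda>m. \<bar>rho n a b (t - lam m)\<bar> * norm (1 / (z + of_real t) ^ (p + 1))) summable_on I"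
      by (intro summable_on_cmult_left abs_summable_rho_lam)
    thus ?thesis by (simp only: k_def norm_mult norm_of_real)
  qed
  have norms: "(\<lambda>m. \<integral>t. norm (k m t) \<partial>lborel) summable_on I"
    by (rule summable_on_comparison_test[OF summable_kernel_bound[of rho_mass]])
       (auto simp only: norm_val K_def intro!: kernel_integrable(2) Bochner_Integration.integral_nonneg norm_ge_zero)
  have sum_eq: "(\<Sum>\<^sub>\<infinity>m\<in>I. k m t) =
      indicator {0<..} t *\<^sub>R (of_real (phi I lam n a b t) / (z + of_real t) ^ (p + 1))" for t
  proof -
    have "((\<lambda>m. k m t) has_sum of_real (phi I lam n a b t) * (1 / (z + of_real t) ^ (p + 1))) I"
      unfolding k_def by (intro has_sum_cmult_left has_sum_of_real has_sum_phi)
    thus ?thesis using phi_eq_0[of t] by (auto simp: indicator_def dest!: infsumI)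
  qed
  show "set_integrable lborel {0<..} (\<lambda>t. of_real (phi I lam n a b t) / (z + of_real t) ^ (p + 1))"
    unfolding set_integrable_def sum_eq[symmetric] by (rule integrable_infsum[OF int ptw norms])
  show "(LINT t:{0<..}|lborel. of_real (phi I lam n a b t) / (z + of_real t) ^ (p + 1)) =
          (\<Sum>\<^sub>\<infinity>m\<in>I. kernel_integral z m)"
    unfolding set_lebesgue_integral_def sum_eq[symmetric]
    using integral_infsum[OF int ptw norms] by (simp only: val)
qed

text \<open>
  The contribution of the zero $-\lambda_m$ is the Laplace transform of $s^p g(s)$ at $z + \lambda_m$.
  The shift by $\lambda_m$ is a factor $e^{-\lambda_m s}$ in the integrand, and these factors add up
  to $h(s)$.
\<close>
lemma laplace_h_g:
  shows "set_integrable lborel {0<..}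
           (\<lambda>s. exp (- of_real s * z) * of_real (s ^ p * h_fun I lam s * g_fun n a b s))"
    and "(LINT s:{0<..}|lborel. exp (- of_real s * z) * of_real (s ^ p * h_fun I lam s * g_fun n a b s)) =
          fact p * (\<Sum>\<^sub>\<infinity>m\<in>I. kernel_integral z m)"
proof -
  define k where "k = (\<lambda>m s. indicator {0<..} s *\<^sub>R
      (exp (- of_real s * (z + of_real (lam m))) * of_real (s ^ p * g_fun n a b s)))"
  define c where "c = (\<lambda>s. indicator {0<..} s *\<^sub>R (exp (- of_real s * z) * of_real (s ^ p * g_fun n a b s)))"
  have Re_pos: "Re (z + of_real (lam m)) > 0" if "m \<in> I" for m
    using z lam_nonneg[OF that] by simp
  have k_eq: "k m s = of_real (exp (- lam m * s)) * c s" for m s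
  proof -
    have "- of_real s * (z + of_real (lam m)) = of_real (- lam m * s) + - of_real s * z"
      by (simp add: algebra_simps)
    hence "exp (- of_real s * (z + of_real (lam m))) = of_real (exp (- lam m * s)) * exp (- of_real s * z)"
      by (simp only: exp_add exp_of_real)
    thus ?thesis by (simp only: k_def c_def scaleR_conv_of_real mult_ac)
  qed
  have int: "integrable lborel (k m)" if "m \<in> I" for m
    unfolding k_def by (rule laplace_g_fun(1)[OF Re_pos[OF that]])
  have val: "(\<integral>s. k m s \<partial>lborel) = fact p * kernel_integral z m" if "m \<in> I" for m
    unfolding k_def laplace_g_fun(2)[OF Re_pos[OF that]] by (simp add: kernel_integral_def)
  have ptw: "(\<lambda>m. norm (k m s)) summable_on I" for s
  proof (cases "s > 0")
    case True
    have "(\<lambda>m. exp (- lam m * s) * norm (c s)) summable_on I"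
      by (intro summable_on_cmult_left summable_exp_lam True)
    thus ?thesis by (simp add: k_eq norm_mult)
  qed (simp add: k_def)
  have norms: "(\<lambda>m. \<integral>s. norm (k m s) \<partial>lborel) summable_on I"
  proof (rule summable_on_comparison_test[OF summable_kernel_bound[of "fact p * rho_mass"]])
    fix m assume m: "m \<in> I"
    show "(\<integral>s. norm (k m s) \<partial>lborel) \<le> 1 / (Re z + lam m) ^ (p + 1) * (fact p * rho_mass)"
      using laplace_g_fun(3)[OF Re_pos[OF m], of p] by (simp add: k_def)
  qed (auto intro!: Bochner_Integration.integral_nonneg)
  have sum_eq: "(\<Sum>\<^sub>\<infinity>m\<in>I. k m s) = indicator {0<..} s *\<^sub>R
      (exp (- of_real s * z) * of_real (s ^ p * h_fun I lam s * g_fun n a b s))" for s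
  proof (cases "s > 0")
    case True
    have "((\<lambda>m. of_real (exp (- lam m * s)) * c s) has_sum of_real (h_fun I lam s) * c s) I"
      unfolding h_fun_def
      by (intro has_sum_cmult_left has_sum_of_real has_sum_infsum summable_exp_lam True)
    hence "(\<Sum>\<^sub>\<infinity>m\<in>I. k m s) = of_real (h_fun I lam s) * c s"
      unfolding k_eq by (rule infsumI)
    thus ?thesis using True by (simp add: c_def mult_ac)
  qed (simp add: k_def)
  show "set_integrable lborel {0<..}
           (\<lambda>s. exp (- of_real s * z) * of_real (s ^ p * h_fun I lam s * g_fun n a b s))"
    unfolding set_integrable_def sum_eq[symmetric] by (rule integrable_infsum[OF int ptw norms])
  have "(LINT s:{0<..}|lborel. exp (- of_real s * z) * of_real (s ^ p * h_fun I lam s * g_fun n a b s)) =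
      (\<Sum>\<^sub>\<infinity>m\<in>I. \<integral>s. k m s \<partial>lborel)"
    unfolding set_lebesgue_integral_def sum_eq[symmetric] by (rule integral_infsum[OF int ptw norms])
  also have "\<dots> = (\<Sum>\<^sub>\<infinity>m\<in>I. fact p * kernel_integral z m)"
    by (intro infsum_cong val)
  also have "\<dots> = fact p * (\<Sum>\<^sub>\<infinity>m\<in>I. kernel_integral z m)"
    by (rule infsum_cmult_right')
  finally show "(LINT s:{0<..}|lborel. exp (- of_real s * z) * of_real (s ^ p * h_fun I lam s * g_fun n a b s)) =
          fact p * (\<Sum>\<^sub>\<infinity>m\<in>I. kernel_integral z m)" .
qed

text \<open>
  The Taylor formula with kernel $\rho$, for a function whose second derivative is a sum over the zeros;
  it is applied to $F(u) = (-1)^p \partial_z^{p-1} \log f(z+u)$.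
\<close>
lemma second_difference_zeros:
  fixes F F' F'' :: "real \<Rightarrow> complex"
  assumes F: "\<And>u. u \<ge> 0 \<Longrightarrow> (F has_vector_derivative F' u) (at u)"
    and F': "\<And>u. u \<ge> 0 \<Longrightarrow> (F' has_vector_derivative F'' u) (at u)"
    and cont: "continuous_on {0..} F''"
    and F''_eq: "\<And>u. u \<ge> 0 \<Longrightarrow>
        F'' u = fact p * (\<Sum>\<^sub>\<infinity>m\<in>I. 1 / (z + of_real u + of_real (lam m)) ^ (p + 1))"
  shows "(\<Sum>k=1..n. F (a k) - F (b k)) = fact p * (\<Sum>\<^sub>\<infinity>m\<in>I. kernel_integral z m)"
proof -
  define K where "K = (\<lambda>m u. of_real (rho n a b u) * (1 / (z + of_real (lam m) + of_real u) ^ (p + 1)))"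
  have ptw: "(\<lambda>m. norm (K m u)) summable_on I" for u
  proof (cases "u \<ge> 0")
    case True
    show ?thesis
    proof (rule summable_on_comparison_test[OF summable_kernel_bound[of "\<bar>rho n a b u\<bar>"]])
      fix m assume "m \<in> I"
      from mult_left_mono[OF norm_kernel_le[OF this True], of "\<bar>rho n a b u\<bar>"]
      show "norm (K m u) \<le> 1 / (Re z + lam m) ^ (p + 1) * \<bar>rho n a b u\<bar>"
        by (simp only: K_def norm_mult norm_of_real mult.commute abs_ge_zero simp_thms)
    qed simp
  qed (simp add: K_def rho_eq_0)
  have norms: "(\<lambda>m. \<integral>u. norm (K m u) \<partial>lborel) summable_on I"
    by (rule summable_on_comparison_test[OF summable_kernel_bound[of rho_mass]])
       (auto simp only: K_def intro!: kernel_integrable(2) Bochner_Integration.integral_nonneg norm_ge_zero)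
  have int: "integrable lborel (K m)" if "m \<in> I" for m
    unfolding K_def by (rule kernel_integrable[OF that])
  have "rho n a b u *\<^sub>R F'' u = fact p * (\<Sum>\<^sub>\<infinity>m\<in>I. K m u)" for u
  proof (cases "u \<ge> 0")
    case True
    have "rho n a b u *\<^sub>R F'' u = fact p * (of_real (rho n a b u) *
        (\<Sum>\<^sub>\<infinity>m\<in>I. 1 / (z + of_real u + of_real (lam m)) ^ (p + 1)))"
      unfolding F''_eq[OF True] scaleR_conv_of_real by (simp only: mult_ac)
    also have "of_real (rho n a b u) * (\<Sum>\<^sub>\<infinity>m\<in>I. 1 / (z + of_real u + of_real (lam m)) ^ (p + 1)) =
        (\<Sum>\<^sub>\<infinity>m\<in>I. K m u)"
      unfolding K_def by (subst infsum_cmult_right'[symmetric]) (simp only: add_ac)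
    finally show ?thesis .
  qed (simp add: K_def rho_eq_0)
  hence "(\<Sum>k=1..n. F (a k) - F (b k)) = (\<integral>u. fact p * (\<Sum>\<^sub>\<infinity>m\<in>I. K m u) \<partial>lborel)"
    using rho_second_difference[OF F F' cont] by (simp add: has_bochner_integral_iff)
  also have "\<dots> = fact p * (\<Sum>\<^sub>\<infinity>m\<in>I. \<integral>u. K m u \<partial>lborel)"
    by (simp only: integral_mult_right_zero integral_infsum[OF int ptw norms])
  finally show ?thesis by (simp only: K_def kernel_integral_def)
qed

end

text \<open>
  The representing measure is $p!\,\phi(t)\,dt$ on $[0,\infty)$. Measurability of $\phi$ is read off from the
  integrability of $\phi(t)/(1+t)^{p+1}$.
\<close>
lemma generalised_Stieltjes_phi:
  assumes nonneg: "\<And>t. rho n a b t \<ge> 0"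
  shows "generalised_Stieltjes (real (p + 1))
      (\<lambda>x. fact p * (LINT t:{0<..}|lborel. phi I lam n a b t / (x + t) ^ (p + 1)))"
proof -
  let ?phi = "phi I lam n a b"
  have phi_nonneg: "?phi t \<ge> 0" for t
    unfolding phi_def by (intro infsum_nonneg nonneg)
  have int: "set_integrable lborel {0<..} (\<lambda>t. ?phi t / (x + t) ^ (p + 1))" if "x > 0" for x
  proof -
    have "set_integrable lborel {0<..} (\<lambda>t. complex_of_real (?phi t / (x + t) ^ (p + 1)))"
      using stieltjes_phi(1)[of "of_real x"] that by simp
    also have "?this \<longleftrightarrow> integrable lborel (\<lambda>t. complex_of_real (indicator {0<..} t *\<^sub>R (?phi t / (x + t) ^ (p + 1))))"
      unfolding set_integrable_def
      by (intro Bochner_Integration.integrable_cong) (auto simp: indicator_def)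
    finally show ?thesis
      unfolding set_integrable_def by (simp only: complex_of_real_integrable_eq)
  qed
  have meas[measurable]: "?phi \<in> borel_measurable borel"
  proof -
    have "(\<lambda>t. indicator {0<..} t *\<^sub>R (?phi t / (1 + t) ^ (p + 1))) \<in> borel_measurable borel"
      using int[of 1] borel_measurable_integrable unfolding set_integrable_def by fastforce
    hence "(\<lambda>t. (indicator {0<..} t *\<^sub>R (?phi t / (1 + t) ^ (p + 1))) * (1 + t) ^ (p + 1)) \<in> borel_measurable borel"
      by measurable
    also have "(\<lambda>t. (indicator {0<..} t *\<^sub>R (?phi t / (1 + t) ^ (p + 1))) * (1 + t) ^ (p + 1)) = ?phi"
      using phi_eq_0 by (auto simp: fun_eq_iff indicator_def)
    finally show ?thesis .
  qed
  define \<mu> where "\<mu> = density (restrict_space lborel {0..}) (\<lambda>t. ennreal (fact p * ?phi t))"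
  have sets: "sets \<mu> = sets (restrict_space borel {0..})"
    unfolding \<mu>_def sets_density by (intro sets_restrict_space_cong) simp
  have meas_r: "g \<in> borel_measurable borel \<Longrightarrow> g \<in> borel_measurable (restrict_space lborel {0..})"
    for g :: "real \<Rightarrow> real"
    by (intro measurable_restrict_space1) simp
  have "integrable \<mu> (\<lambda>t. 1 / (t + x) powr real (p + 1)) \<and>
     fact p * (LINT t:{0<..}|lborel. ?phi t / (x + t) ^ (p + 1)) =
     (\<integral>t. 1 / (t + x) powr real (p + 1) \<partial>\<mu>) + 0" if x: "x > 0" for x
  proof -
    have eq: "indicator {0..} t *\<^sub>R ((fact p * ?phi t) *\<^sub>R (1 / (t + x) powr real (p + 1))) =
        fact p * (indicator {0<..} t *\<^sub>R (?phi t / (x + t) ^ (p + 1)))" for t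
      using phi_eq_0[of 0] x
      by (cases "t = 0") (auto simp: indicator_def powr_realpow add_ac simp del: power_Suc of_nat_Suc of_nat_add)
    have g: "(\<lambda>t. 1 / (t + x) powr real (p + 1)) \<in> borel_measurable (restrict_space lborel {0..})"
      by (rule meas_r) measurable
    have d: "(\<lambda>t. fact p * ?phi t) \<in> borel_measurable (restrict_space lborel {0..})"
      by (rule meas_r) measurable
    have ae: "AE t in restrict_space lborel {0..}. 0 \<le> fact p * ?phi t"
      using phi_nonneg by simp
    have "integrable \<mu> (\<lambda>t. 1 / (t + x) powr real (p + 1))"
      unfolding \<mu>_def integrable_density[OF g d ae]
      by (subst integrable_restrict_space)
         (use int[OF x] in \<open>simp_all only: eq set_integrable_def integrable_mult_right space_lborel Int_UNIV_right, simp_all\<close>)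
    moreover have "(\<integral>t. 1 / (t + x) powr real (p + 1) \<partial>\<mu>) =
        (\<integral>t. fact p * (indicator {0<..} t *\<^sub>R (?phi t / (x + t) ^ (p + 1))) \<partial>lborel)"
      unfolding \<mu>_def integral_density[OF g d ae] by (subst integral_restrict_space) (simp_all only: eq, simp)
    ultimately show ?thesis
      by (simp only: integral_mult_right_zero set_lebesgue_integral_def add_0_right)
  qed
  thus ?thesis unfolding generalised_Stieltjes_def
    using sets by (intro conjI exI[of _ \<mu>] exI[of _ 0]) auto
qed

end

section \<open>The logarithm of a function in the class\<close>

text \<open>
  For $w \le 0$ one has $|z-w| \ge \Re z + |w|$. Of the $p+1$ factors $|z-w|$, $r+1$ are estimated by
  $|w|$ and the others by $\Re z$.
\<close>
lemma summable_inverse_powers_half_plane: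
  fixes w :: "nat \<Rightarrow> complex"
  assumes w: "\<And>i. i \<in> J \<Longrightarrow> w i \<in> \<real>\<^sub>\<le>\<^sub>0 - {0}"
    and sum: "(\<lambda>i. 1 / norm (w i) ^ (r + 1)) summable_on J"
    and "r \<le> p" "Re z > 0"
  shows "(\<lambda>i. 1 / (z - w i) ^ (p + 1)) summable_on J"
proof (rule abs_summable_summable)
  have "(\<lambda>i. 1 / norm (w i) ^ (r + 1) * (1 / Re z ^ (p - r))) summable_on J"
    by (intro summable_on_cmult_left sum)
  thus "(\<lambda>i. norm (1 / (z - w i) ^ (p + 1))) summable_on J"
  proof (rule summable_on_comparison_test)
    fix i assume i: "i \<in> J"
    have nw: "norm (w i) = - Re (w i)" "norm (w i) > 0"
      using w[OF i] by (auto simp: complex_nonpos_Reals_iff cmod_def complex_eq_iff)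
    have "Re z + norm (w i) = Re (z - w i)" by (simp add: nw(1))
    also have "\<dots> \<le> norm (z - w i)" by (rule complex_Re_le_cmod)
    finally have le: "Re z + norm (w i) \<le> norm (z - w i)" .
    have "norm (w i) ^ (r + 1) * Re z ^ (p - r) \<le> norm (z - w i) ^ (r + 1) * norm (z - w i) ^ (p - r)"
    proof -
      have "norm (w i) \<le> norm (z - w i)" "Re z \<le> norm (z - w i)"
        using le nw(2) assms(4) by linarith+
      thus ?thesis using assms(4) by (intro mult_mono power_mono) auto
    qed
    also have "\<dots> = norm (z - w i) ^ (p + 1)"
      using assms(3) by (simp add: power_add[symmetric] del: power_Suc)
    finally have "norm (w i) ^ (r + 1) * Re z ^ (p - r) \<le> norm (z - w i) ^ (p + 1)" .
    moreover have "norm (z - w i) > 0" using le nw(2) assms(4) by linarith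
    ultimately have "1 / norm (z - w i) ^ (p + 1) \<le> 1 / (norm (w i) ^ (r + 1) * Re z ^ (p - r))"
      using nw(2) assms(4) by (intro divide_left_mono mult_pos_pos zero_less_power) auto
    thus "norm (1 / (z - w i) ^ (p + 1)) \<le> 1 / norm (w i) ^ (r + 1) * (1 / Re z ^ (p - r))"
      by (simp add: norm_divide norm_power del: power_Suc)
  qed simp
qed

lemma has_sum_Plus:
  fixes f :: "'i + 'j \<Rightarrow> 'b::{topological_comm_monoid_add, t2_space}"
  assumes "((\<lambda>i. f (Inl i)) has_sum S) A" "((\<lambda>j. f (Inr j)) has_sum S') B"
  shows "(f has_sum (S + S')) (A <+> B)"
  unfolding Plus_def
  by (rule has_sum_Un_disjoint) (use assms in \<open>auto simp: has_sum_reindex o_def\<close>)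

text \<open>
  The Hadamard factorisation gives this formula with the sum over the zeros as they are enumerated in
  the factorisation, the zero at the origin being the factor $z^d$. Both enumerations list every point
  as often as the order of vanishing of $f$, so they are rearrangements of each other, and the
  sum is unordered.
\<close>
lemma higher_deriv_log_branch:
  assumes p: "p \<ge> 1" and f: "f \<in> class_E p" and zeros: "lists_zeros f I lam" and z: "Re z > 0"
  shows "((\<lambda>m. 1 / (z + of_real (lam m)) ^ (p + 1)) has_sum
            ((deriv ^^ (p + 1)) (log_branch f) z / ((-1) ^ p * fact p))) I"
proof -
  have holo: "f holomorphic_on UNIV" and genus: "has_genus f p"
    and real: "\<And>x::real. f (of_real x) \<in> \<real>" and nonpos: "\<And>z. f z = 0 \<Longrightarrow> z \<in> \<real>\<^sub>\<le>\<^sub>0"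
    and pos: "\<And>x::real. x > 0 \<Longrightarrow> Re (f (of_real x)) > 0"
    using f by (auto simp: class_E_def)
  obtain d q r J w where w_nz: "\<And>i. i \<in> J \<Longrightarrow> w i \<noteq> 0"
    and sum: "(\<lambda>i. 1 / norm (w i) ^ (r + 1)) summable_on J"
    and f_eq: "\<And>z. f z = z ^ d * exp (poly q z) * (\<Prod>i. if i \<in> J then weierstrass_factor r (z / w i) else 1)"
    and p_eq: "p = max (degree q) r"
    using genus unfolding has_genus_def by blast
  interpret weierstrass_family r J w
    using w_nz sum by unfold_locales
  have f_eq': "f z = z ^ d * exp (poly q z) * canonical_product z" for z
    by (simp add: f_eq canonical_product_def factor_def)
  have w: "w i \<in> \<real>\<^sub>\<le>\<^sub>0 - {0}" if "i \<in> J" for i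
  proof -
    have "canonical_product (w i) = 0" using that by (auto simp: canonical_product_eq_0_iff)
    hence "f (w i) = 0" by (simp add: f_eq')
    thus ?thesis using nonpos w_nz[OF that] by auto
  qed

  \<comment> \<open>The zeros in the factorisation: \<open>d\<close> copies of the origin, followed by the family \<open>w\<close>.\<close>
  define A where "A = {..<d} <+> J"
  define u where "u = case_sum (\<lambda>_::nat. 0) w"
  have fibre: "{i\<in>A. u i = c} = (if c = 0 then {..<d} else {}) <+> {i\<in>J. w i = c}" for c
  proof (rule set_eqI)
    fix x
    show "x \<in> {i\<in>A. u i = c} \<longleftrightarrow> x \<in> (if c = 0 then {..<d} else {}) <+> {i\<in>J. w i = c}"
      by (cases x) (auto simp: A_def u_def)
  qed
  have fin_fibre: "finite {i\<in>A. u i = c}" for c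
    unfolding fibre using finite_fibre by auto
  have card_fibre: "card {i\<in>A. u i = c} = (if c = 0 then d else 0) + card {i\<in>J. w i = c}" for c
    unfolding fibre using finite_fibre by (auto simp: card_Plus)
  have zorder: "zorder f c = int (card {i\<in>A. u i = c})" for c
    unfolding card_fibre by (rule zorder_eq_count[OF f_eq'])
  have zero_iff: "f c = 0 \<longleftrightarrow> {i\<in>A. u i = c} \<noteq> {}" for c
    unfolding fibre by (auto simp: f_eq' canonical_product_eq_0_iff)
  define v where "v = (\<lambda>m. - complex_of_real (lam m))"
  have v: "finite {m\<in>I. v m = c} \<and> card {i\<in>A. u i = c} = card {m\<in>I. v m = c}" for c
  proof (cases "f c = 0")
    case True
    have "int (card {m\<in>I. v m = c}) = zorder f c"
      using zeros True by (auto simp: lists_zeros_def v_def)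
    hence eq: "card {m\<in>I. v m = c} = card {i\<in>A. u i = c}"
      by (simp add: zorder)
    \<comment> \<open>A set of positive cardinality is finite, so the listed zeros at \<open>c\<close> are finitely many.\<close>
    moreover have "card {i\<in>A. u i = c} > 0"
      using True zero_iff fin_fibre by (simp add: card_gt_0_iff)
    ultimately show ?thesis using card_ge_0_finite by metis
  next
    case False
    have "{m\<in>I. v m = c} = {}"
      using zeros False by (auto simp: lists_zeros_def v_def)
    moreover have "{i\<in>A. u i = c} = {}" using False zero_iff by blast
    ultimately show ?thesis by (simp only: finite.emptyI card.empty simp_thms)
  qed
  obtain h where h: "bij_betw h A I" "\<And>i. i \<in> A \<Longrightarrow> v (h i) = u i"
    using exists_fibrewise_bij_betw[of A u I v] fin_fibre v by blast

  define S where "S = (\<Sum>\<^sub>\<infinity>i\<in>J. 1 / (z - w i) ^ (p + 1))"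
  have S: "((\<lambda>i. 1 / (z - w i) ^ (p + 1)) has_sum S) J"
    unfolding S_def
    by (intro has_sum_infsum summable_inverse_powers_half_plane[OF w sum _ z]) (use p_eq in auto)
  have "((\<lambda>i. 1 / (z - u i) ^ (p + 1)) has_sum (of_nat d / z ^ (p + 1) + S)) A"
    unfolding A_def
  proof (rule has_sum_Plus)
    have "((\<lambda>i. 1 / (z - u (Inl i)) ^ (p + 1)) has_sum (\<Sum>i<d. 1 / (z - u (Inl i)) ^ (p + 1))) {..<d}"
      by (rule has_sum_finite) simp
    thus "((\<lambda>i. 1 / (z - u (Inl i)) ^ (p + 1)) has_sum of_nat d / z ^ (p + 1)) {..<d}"
      by (simp add: u_def)
  qed (use S in \<open>simp add: u_def\<close>)
  also have "?this \<longleftrightarrow> ((\<lambda>i. 1 / (z - v (h i)) ^ (p + 1)) has_sum (of_nat d / z ^ (p + 1) + S)) A"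
    by (intro has_sum_cong) (simp add: h(2))
  also have "\<dots> \<longleftrightarrow> ((\<lambda>m. 1 / (z - v m) ^ (p + 1)) has_sum (of_nat d / z ^ (p + 1) + S)) I"
    by (rule has_sum_reindex_bij_betw[OF h(1)])
  finally have sum_I: "((\<lambda>m. 1 / (z + of_real (lam m)) ^ (p + 1)) has_sum (of_nat d / z ^ (p + 1) + S)) I"
    by (simp add: v_def)

  note L = log_branch_properties[OF holo nonpos real pos]
  have z_slit: "z \<in> - \<real>\<^sub>\<le>\<^sub>0" using z by (auto simp: complex_nonpos_Reals_iff)
  have "(\<lambda>N. (-1) ^ p * fact p * (of_nat d / z ^ (p + 1) +
            (\<Sum>i<N. if i \<in> J then 1 / (z - w i) ^ (p + 1) else 0)))
          \<longlonglongrightarrow> (deriv ^^ (p + 1)) (log_branch f) z"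
    by (rule tendsto_higher_deriv_log[OF f_eq' L(1)])
       (use L(2) p p_eq z_slit in \<open>auto simp: open_Compl\<close>)
  moreover have "(\<lambda>N. (-1) ^ p * fact p * (of_nat d / z ^ (p + 1) +
            (\<Sum>i<N. if i \<in> J then 1 / (z - w i) ^ (p + 1) else 0)))
          \<longlonglongrightarrow> (-1) ^ p * fact p * (of_nat d / z ^ (p + 1) + S)"
    using has_sum_imp_sums_restrict[OF S] unfolding sums_def by (intro tendsto_intros)
  ultimately have "(deriv ^^ (p + 1)) (log_branch f) z = (-1) ^ p * fact p * (of_nat d / z ^ (p + 1) + S)"
    by (rule LIMSEQ_unique)
  thus ?thesis using sum_I by simp
qed

section \<open>The logarithm of the quotient\<close>

lemma higher_deriv_log_W:
  assumes L: "log_branch f holomorphic_on - \<real>\<^sub>\<le>\<^sub>0"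
    and nonneg: "\<And>k. k \<in> {1..n} \<Longrightarrow> 0 \<le> a k" "\<And>k. k \<in> {1..n} \<Longrightarrow> 0 \<le> b k" and z: "Re z > 0"
  shows "(deriv ^^ j) (log_W f n a b) z =
    (\<Sum>k=1..n. (deriv ^^ j) (log_branch f) (z + of_real (a k)) - (deriv ^^ j) (log_branch f) (z + of_real (b k)))"
proof -
  let ?H = "{z. Re z > 0}"
  have op: "open ?H" by (simp add: open_halfspace_Re_gt)
  have sub: "1 * z + of_real c \<in> - \<real>\<^sub>\<le>\<^sub>0" if "z \<in> ?H" "0 \<le> c" for z and c :: real
    using that by (auto simp: complex_nonpos_Reals_iff)
  have shift: "(deriv ^^ j) (\<lambda>z. log_branch f (z + of_real c)) z = (deriv ^^ j) (log_branch f) (z + of_real c)"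
    if "0 \<le> c" for c :: real
    using higher_deriv_compose_linear'[OF L op _ _ sub[OF _ that], of z j] z by (simp add: open_Compl)
  have holo: "(\<lambda>z. log_branch f (z + of_real c)) holomorphic_on ?H" if "0 \<le> c" for c :: real
  proof -
    have "(log_branch f \<circ> (\<lambda>z. z + of_real c)) holomorphic_on ?H"
    proof (rule holomorphic_on_compose_gen[OF _ L])
      show "(\<lambda>z. z + of_real c) holomorphic_on ?H" by (intro holomorphic_intros)
      show "(\<lambda>z. z + of_real c) ` ?H \<subseteq> - \<real>\<^sub>\<le>\<^sub>0" using sub[OF _ that] by auto
    qed
    thus ?thesis by (simp add: o_def)
  qed
  have "(deriv ^^ j) (log_W f n a b) z =
      (\<Sum>k=1..n. (deriv ^^ j) (\<lambda>z. log_branch f (z + of_real (a k)) - log_branch f (z + of_real (b k))) z)"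
    unfolding log_W_def[abs_def]
    by (rule higher_deriv_sum[where S = ?H]) (use op z holo nonneg in \<open>auto intro!: holomorphic_on_diff\<close>)
  also have "\<dots> = (\<Sum>k=1..n. (deriv ^^ j) (log_branch f) (z + of_real (a k)) - (deriv ^^ j) (log_branch f) (z + of_real (b k)))"
  proof (intro sum.cong refl)
    fix k assume k: "k \<in> {1..n}"
    show "(deriv ^^ j) (\<lambda>z. log_branch f (z + of_real (a k)) - log_branch f (z + of_real (b k))) z =
        (deriv ^^ j) (log_branch f) (z + of_real (a k)) - (deriv ^^ j) (log_branch f) (z + of_real (b k))"
      using z by (subst higher_deriv_diff[OF holo[OF nonneg(1)[OF k]] holo[OF nonneg(2)[OF k]] op])
        (simp_all only: shift[OF nonneg(1)[OF k]] shift[OF nonneg(2)[OF k]], simp)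
  qed
  finally show ?thesis .
qed

theorem theorem1p2:
  fixes p n :: nat
    and f :: "complex \<Rightarrow> complex"
    and I :: "nat set"
    and lam a b :: "nat \<Rightarrow> real"
  assumes p: "p \<ge> 1"
    and f: "f \<in> class_E p"
    and zeros: "lists_zeros f I lam"
    and a: "mono_on {1..n} a" "\<forall>k\<in>{1..n}. 0 \<le> a k"
    and b: "mono_on {1..n} b" "\<forall>k\<in>{1..n}. 0 \<le> b k"
    and sum_eq: "(\<Sum>k=1..n. a k) = (\<Sum>k=1..n. b k)"
  shows "(\<forall>s>0. (\<lambda>m. exp (- lam m * s)) summable_on I) \<and>
    (\<forall>t. (\<lambda>m. rho n a b (t - lam m)) summable_on I) \<and>
    (\<forall>z. Re z > 0 \<longrightarrow>
       set_integrable lborel {0<..}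
         (\<lambda>s. exp (- of_real s * z) * of_real (s ^ p * h_fun I lam s * g_fun n a b s)) \<and>
       set_integrable lborel {0<..}
         (\<lambda>t. of_real (phi I lam n a b t) / (z + of_real t) ^ (p + 1)) \<and>
       (-1) ^ p * (deriv ^^ (p - 1)) (log_W f n a b) z =
         (LINT s:{0<..}|lborel.
            exp (- of_real s * z) * of_real (s ^ p * h_fun I lam s * g_fun n a b s)) \<and>
       (LINT s:{0<..}|lborel.
            exp (- of_real s * z) * of_real (s ^ p * h_fun I lam s * g_fun n a b s)) =
         Gamma (of_nat p + 1) *
         (LINT t:{0<..}|lborel.
            of_real (phi I lam n a b t) / (z + of_real t) ^ (p + 1))) \<and>
    (weak_supermajorised n b a \<longrightarrow>
       generalised_Stieltjes_complex (real (p + 1))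
         (\<lambda>z. (-1) ^ p * (deriv ^^ (p - 1)) (log_W f n a b) z))"
proof -
  let ?L = "log_branch f"
  have L: "?L holomorphic_on - \<real>\<^sub>\<le>\<^sub>0"
    using f by (intro log_branch_properties) (auto simp: class_E_def)
  have L_sum: "((\<lambda>m. 1 / (z + of_real (lam m)) ^ (p + 1)) has_sum
            ((deriv ^^ (p + 1)) ?L z / ((-1) ^ p * fact p))) I" if "Re z > 0" for z
    by (rule higher_deriv_log_branch[OF p f zeros that])
  interpret shifts_and_zeros n a b p I lam
  proof
    show "0 \<le> lam m" if "m \<in> I" for m
      using zeros that by (auto simp: lists_zeros_def)
    show "(\<lambda>m. 1 / (x + lam m) ^ (p + 1)) summable_on I" if "x > 0" for x
    proof -
      have "(\<lambda>m. 1 / (complex_of_real x + of_real (lam m)) ^ (p + 1)) summable_on I"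
        by (rule has_sum_imp_summable[OF L_sum]) (use that in simp)
      hence "(\<lambda>m. complex_of_real (1 / (x + lam m) ^ (p + 1))) summable_on I"
        by simp
      from summable_on_bounded_linear[OF bounded_linear_Re this]
      show ?thesis by (simp only: Re_complex_of_real)
    qed
  qed (use a b sum_eq in auto)
  have main: "(-1) ^ p * (deriv ^^ (p - 1)) (log_W f n a b) z = fact p * (\<Sum>\<^sub>\<infinity>m\<in>I. kernel_integral z m)"
    if z: "Re z > 0" for z
  proof -
    let ?D = "\<lambda>j u. (-1) ^ p * (deriv ^^ j) ?L (z + of_real u)"
    have slit: "z + of_real u \<in> - \<real>\<^sub>\<le>\<^sub>0" if "u \<ge> 0" for u :: real
      using z that by (auto simp: complex_nonpos_Reals_iff)
    have deriv: "(?D j has_vector_derivative ?D (Suc j) u) (at u)" if u: "u \<ge> 0" for j and u :: real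
    proof -
      have "((deriv ^^ j) ?L has_field_derivative (deriv ^^ Suc j) ?L (z + of_real u)) (at (z + of_real u))"
        by (rule has_field_derivative_higher_deriv[OF L _ slit[OF u]]) (simp add: open_Compl)
      hence "((\<lambda>x. (deriv ^^ j) ?L (z + x)) has_field_derivative (deriv ^^ Suc j) ?L (z + of_real u)) (at (of_real u))"
        using DERIV_shift[of "(deriv ^^ j) ?L" _ "of_real u" z] by (simp add: add.commute)
      from has_vector_derivative_real_field[OF DERIV_cmult[OF this, of "(-1) ^ p"]]
      show ?thesis .
    qed
    have "(-1) ^ p * (deriv ^^ (p - 1)) (log_W f n a b) z = (\<Sum>k=1..n. ?D (p - 1) (a k) - ?D (p - 1) (b k))"
      by (subst higher_deriv_log_W[OF L a_nonneg b_nonneg z])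
         (simp_all add: sum_distrib_left right_diff_distrib)
    also have "\<dots> = fact p * (\<Sum>\<^sub>\<infinity>m\<in>I. kernel_integral z m)"
    proof (rule second_difference_zeros[OF z deriv])
      show "(?D (Suc (p - 1)) has_vector_derivative ?D (p + 1) u) (at u)" if "u \<ge> 0" for u
        using deriv[OF that, of p] p by simp
      show "continuous_on {0..} (?D (p + 1))"
        by (intro continuous_on_mult continuous_on_const
              continuous_on_compose2[OF holomorphic_on_imp_continuous_on[OF holomorphic_higher_deriv[OF L]]])
           (use slit in \<open>auto intro!: continuous_intros simp: open_Compl\<close>)
      show "?D (p + 1) u = fact p * (\<Sum>\<^sub>\<infinity>m\<in>I. 1 / (z + of_real u + of_real (lam m)) ^ (p + 1))"
        if "u \<ge> 0" for u
      proof -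
        have "(\<Sum>\<^sub>\<infinity>m\<in>I. 1 / (z + of_real u + of_real (lam m)) ^ (p + 1)) =
          (deriv ^^ (p + 1)) ?L (z + of_real u) / ((-1) ^ p * fact p)"
          by (intro infsumI L_sum) (use z that in simp)
        thus ?thesis by (cases "even p") simp_all
      qed
    qed
    finally show ?thesis .
  qed
  have gamma: "Gamma (of_nat p + 1) = (fact p :: complex)"
    using Gamma_fact[of p] by (simp add: add.commute)
  have stieltjes: "generalised_Stieltjes_complex (real (p + 1))
         (\<lambda>z. (-1) ^ p * (deriv ^^ (p - 1)) (log_W f n a b) z)" if maj: "weak_supermajorised n b a"
    unfolding generalised_Stieltjes_complex_def
  proof (intro exI conjI allI impI)
    show "generalised_Stieltjes (real (p + 1))
      (\<lambda>x. fact p * (LINT t:{0<..}|lborel. phi I lam n a b t / (x + t) ^ (p + 1)))"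
      by (rule generalised_Stieltjes_phi[OF rho_nonneg[OF b(1) maj]])
    fix x :: real assume x: "x > 0"
    have "(LINT t:{0<..}|lborel. of_real (phi I lam n a b t) / (complex_of_real x + of_real t) ^ (p + 1)) =
       of_real (LINT t:{0<..}|lborel. phi I lam n a b t / (x + t) ^ (p + 1))"
      unfolding set_lebesgue_integral_def integral_complex_of_real[symmetric]
      by (intro Bochner_Integration.integral_cong) (auto simp: indicator_def)
    thus "(-1) ^ p * (deriv ^^ (p - 1)) (log_W f n a b) (of_real x) =
      of_real (fact p * (LINT t:{0<..}|lborel. phi I lam n a b t / (x + t) ^ (p + 1)))"
      using main[of "of_real x"] stieltjes_phi(2)[of "of_real x"] x by simp
  qed
  show ?thesis
  proof (intro conjI allI impI)
    fix z :: complex assume z: "Re z > 0"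
    show "(-1) ^ p * (deriv ^^ (p - 1)) (log_W f n a b) z =
         (LINT s:{0<..}|lborel.
            exp (- of_real s * z) * of_real (s ^ p * h_fun I lam s * g_fun n a b s))"
      unfolding main[OF z] laplace_h_g(2)[OF z] ..
    show "(LINT s:{0<..}|lborel.
            exp (- of_real s * z) * of_real (s ^ p * h_fun I lam s * g_fun n a b s)) =
         Gamma (of_nat p + 1) *
         (LINT t:{0<..}|lborel.
            of_real (phi I lam n a b t) / (z + of_real t) ^ (p + 1))"
      unfolding stieltjes_phi(2)[OF z] laplace_h_g(2)[OF z] gamma ..
  qed (rule summable_exp_lam summable_rho_lam laplace_h_g(1) stieltjes_phi(1) stieltjes; assumption)+
qed

end
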